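(* Let $K$ be a number field and $\mathfrak{p}$ a nonzero prime ideal of $\mathcal{O}_K$. The arithmetic partial derivative $D_{K,\mathfrak{p}}$ is strictly differentiable and twice strictly differentiable (with respect to the ultrametric absolute value $|\cdot|_{\nu_{\mathfrak{p}}}$) at every nonzero $x \in K$.
   Context: For a nonzero prime ideal $\mathfrak{q}$ of the ring of integers of a number field lying over the rational prime $q$, $\nu_{\mathfrak{q}}$ denotes the associated discrete valuation normalized to extend $\nu_q$, and for a finite Galois extension $L/\mathbb{Q}$, $g(q,L)$ is the number of prime ideals of $\mathcal{O}_L$ over $q$. For $L/\mathbb{Q}$ finite Galois and a set $T'$ of nonzero prime ideals of $\mathcal{O}_L$, $D_{L,T'}(0)=0$ and $D_{L,T'}(x) := x\sum_{\mathfrak{Q}\in T'} \frac{\nu_{\mathfrak{Q}}(x)}{q\,g(q,L)}$ for $x\ne 0$ ($q$ the prime below $\mathfrak{Q}$). For a number field $K$ and a set $T$ of prime ideals of $\mathcal{O}_K$, choose a finite extension $L/K$ with $L/\mathbb{Q}$ Galois, let $T_{L/K}$ be the prime ideals of $\mathcal{O}_L$ lying over elements of $T$, and set $D_{K,T}(x) := D_{L,T_{L/K}}(x)$ (independent of $L$); $D_{K,\mathfrak{p}} := D_{K,\{\mathfrak{p}\}}$. $|x|_{\nu_{\mathfrak{p}}} = c^{\nu_{\mathfrak{p}}(x)}$ for a fixed $0<c<1$. A function $f:K\to K$ is strictly differentiable at $x$ if $\Phi f(u,v) = \frac{f(u)-f(v)}{u-v}$ has a limit as $(u,v) \to (x,x)$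 with $u \neq v$; it is twice strictly differentiable at $x$ if $\Phi_2 f(u,v,w) = \frac{\Phi f(u,w) - \Phi f(v,w)}{u-v}$ has a limit as $(u,v,w)\to(x,x,x)$ with $u,v,w$ pairwise distinct. *)

theory Defs
  imports
    Complex_Main
    "HOL-Computational_Algebra.Computational_Algebra"
    "HOL-Algebra.Algebra"
    "HOL-Algebra.Algebraic_Closure_Type"
begin

text \<open>
  Number fields are taken inside an arbitrary algebraically closed field \<open>'a\<close> of
  characteristic 0, so that a Galois extension of the rationals containing a given number field
  is again a subset of \<open>'a\<close>. Every number field is isomorphic to such a subfield, for instance
  of \<open>complex\<close> or of its own algebraic closure.
\<close>

definition number_field :: "'a::field_char_0 set \<Rightarrow> bool" where
  "number_field K \<longleftrightarrow>
     subfield K ring_of_type_algebra \<and> ring.finite_dimension ring_of_type_algebra \<rat> K"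

definition ring_of_integers :: "'a::field_char_0 set \<Rightarrow> 'a ring" where
  "ring_of_integers K = ring_of_type_algebra \<lparr>carrier := {x \<in> K. algebraic_int x}\<rparr>"

definition prime_ideals :: "'a::field_char_0 set \<Rightarrow> 'a set set" where
  "prime_ideals K = {P. primeideal P (ring_of_integers K) \<and> P \<noteq> {0}}"

definition prime_below :: "'a::field_char_0 set \<Rightarrow> nat" where
  "prime_below P = (THE q. Factorial_Ring.prime q \<and> P \<inter> \<int> = {of_int (int q * k) | k. True})"

text \<open>
  The exponent of \<open>P\<close> in the prime ideal factorisation of the fractional ideal generated by
  \<open>x\<close>, for \<open>x \<noteq> 0\<close>: first for integral elements (the exponent of \<open>P\<close> in the ideal generated by
  \<open>a\<close> is the largest \<open>n\<close> with \<open>a\<close> in the \<open>n\<close>-th power of \<open>P\<close>), then for fractions of such.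
\<close>

definition ord_integral :: "'a::field_char_0 set \<Rightarrow> 'a set \<Rightarrow> 'a \<Rightarrow> nat" where
  "ord_integral K P a = (GREATEST n. a \<in> P [^]\<^bsub>ideals_set (ring_of_integers K)\<^esub> (n::nat))"

definition ord_at :: "'a::field_char_0 set \<Rightarrow> 'a set \<Rightarrow> 'a \<Rightarrow> int" where
  "ord_at K P x =
     (THE k. \<exists>a\<in>carrier (ring_of_integers K). \<exists>b\<in>carrier (ring_of_integers K).
        a \<noteq> 0 \<and> b \<noteq> 0 \<and> x = a / b \<and> k = int (ord_integral K P a) - int (ord_integral K P b))"

text \<open>
  Dividing by the ramification index makes the valuation extend the one of the rational prime
  below \<open>P\<close>. Only values at \<open>x \<noteq> 0\<close> are meaningful.
\<close>

definition valuation :: "'a::field_char_0 set \<Rightarrow> 'a set \<Rightarrow> 'a \<Rightarrow> rat" where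
  "valuation K P x = of_int (ord_at K P x) / of_int (ord_at K P (of_nat (prime_below P)))"

definition abs_val :: "real \<Rightarrow> 'a::field_char_0 set \<Rightarrow> 'a set \<Rightarrow> 'a \<Rightarrow> real" where
  "abs_val c K P x = (if x = 0 then 0 else c powr real_of_rat (valuation K P x))"

text \<open>
  Finite, normal and separable over the rationals: an irreducible rational polynomial with a root
  in \<open>L\<close> is a product of distinct linear factors over \<open>L\<close>.
\<close>

definition galois_over_rat :: "'a::field_char_0 set \<Rightarrow> bool" where
  "galois_over_rat L \<longleftrightarrow> number_field L \<and>
     (\<forall>f :: rat poly. Factorial_Ring.irreducible f \<and> (\<exists>x\<in>L. poly (map_poly of_rat f) x = 0) \<longrightarrow>
        card {x \<in> L. poly (map_poly of_rat f) x = 0} = Polynomial.degree f)"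

definition num_primes_over :: "nat \<Rightarrow> 'a::field_char_0 set \<Rightarrow> nat" where
  "num_primes_over q L = card {Q \<in> prime_ideals L. prime_below Q = q}"

text \<open>
  The set \<open>T\<close> may be infinite, but only finitely many terms of the sum are nonzero; the sum is
  taken over these, since sums over infinite sets are 0 by convention.
\<close>

definition arith_deriv_galois :: "'a::field_char_0 set \<Rightarrow> 'a set set \<Rightarrow> 'a \<Rightarrow> 'a" where
  "arith_deriv_galois L T x =
     (if x = 0 then 0
      else x * of_rat (\<Sum>Q | Q \<in> T \<and> valuation L Q x \<noteq> 0.
        valuation L Q x / (of_nat (prime_below Q) * of_nat (num_primes_over (prime_below Q) L))))"

definition primes_above ::
    "'a::field_char_0 set \<Rightarrow> 'a set \<Rightarrow> 'a set set \<Rightarrow> 'a set set" where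
  "primes_above L K T = {Q \<in> prime_ideals L. Q \<inter> carrier (ring_of_integers K) \<in> T}"

definition galois_extension :: "'a::{alg_closed_field, field_char_0} set \<Rightarrow> 'a set" where
  "galois_extension K = (SOME L. K \<subseteq> L \<and> galois_over_rat L)"

definition arith_deriv ::
    "'a::{alg_closed_field, field_char_0} set \<Rightarrow> 'a set set \<Rightarrow> 'a \<Rightarrow> 'a" where
  "arith_deriv K T = (let L = galois_extension K in arith_deriv_galois L (primes_above L K T))"

definition diff_quot :: "('a::field \<Rightarrow> 'a) \<Rightarrow> 'a \<Rightarrow> 'a \<Rightarrow> 'a" where
  "diff_quot f u v = (f u - f v) / (u - v)"

definition diff_quot2 :: "('a::field \<Rightarrow> 'a) \<Rightarrow> 'a \<Rightarrow> 'a \<Rightarrow> 'a \<Rightarrow> 'a" where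
  "diff_quot2 f u v w = (diff_quot f u w - diff_quot f v w) / (u - v)"

text \<open>
  In the following, \<open>N\<close> is the absolute value on \<open>K\<close>, and \<open>f\<close> is regarded as a function from
  \<open>K\<close> to \<open>K\<close>; its values outside \<open>K\<close> play no role, and the limits are taken in \<open>K\<close>.
\<close>

definition strictly_differentiable_at ::
    "('a::field \<Rightarrow> real) \<Rightarrow> 'a set \<Rightarrow> ('a \<Rightarrow> 'a) \<Rightarrow> 'a \<Rightarrow> bool" where
  "strictly_differentiable_at N K f x \<longleftrightarrow>
     (\<exists>l\<in>K. \<forall>\<epsilon>>0. \<exists>\<delta>>0. \<forall>u\<in>K. \<forall>v\<in>K.
        u \<noteq> v \<and> N (u - x) < \<delta> \<and> N (v - x) < \<delta> \<longrightarrow> N (diff_quot f u v - l) < \<epsilon>)"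

definition twice_strictly_differentiable_at ::
    "('a::field \<Rightarrow> real) \<Rightarrow> 'a set \<Rightarrow> ('a \<Rightarrow> 'a) \<Rightarrow> 'a \<Rightarrow> bool" where
  "twice_strictly_differentiable_at N K f x \<longleftrightarrow>
     (\<exists>l\<in>K. \<forall>\<epsilon>>0. \<exists>\<delta>>0. \<forall>u\<in>K. \<forall>v\<in>K. \<forall>w\<in>K.
        u \<noteq> v \<and> u \<noteq> w \<and> v \<noteq> w \<and> N (u - x) < \<delta> \<and> N (v - x) < \<delta> \<and> N (w - x) < \<delta> \<longrightarrow>
        N (diff_quot2 f u v w - l) < \<epsilon>)"

end

theory Submission
  imports Defs
begin

text \<open>
  If \<open>u \<in> K\<close> is closer to \<open>x\<close> than \<open>x\<close> is to \<open>0\<close>, then \<open>u / x = s / t\<close> with integral \<open>s\<close> and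
  \<open>t\<close> outside \<open>P\<close>. Such \<open>s\<close> and \<open>t\<close> lie outside every prime \<open>Q\<close> above \<open>P\<close>, so \<open>u\<close> and \<open>x\<close> have the
  same valuation at \<open>Q\<close>. Hence the arithmetic partial derivative is \<open>u \<mapsto> l * u\<close> with a rational
  constant \<open>l\<close> near \<open>x\<close>: the first difference quotients equal \<open>l\<close> and the second ones vanish.

  That the order at \<open>P\<close> is well defined and governs divisibility is the statement that the
  localisation of the ring of integers at \<open>P\<close> is a discrete valuation ring. Here \<open>q\<close> denotes the rational
  prime below \<open>P\<close>. Everything follows from finiteness of the residue ring modulo \<open>q\<close>: integral
  elements independent modulo \<open>q\<close> are independent over the rationals, so the residue ring has
  dimension at most the degree of \<open>K\<close>. Pigeonhole on powers then shows that \<open>P\<close> is maximal, that some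
  \<open>g \<in> K\<close> which is not integral satisfies \<open>g P \<subseteq> \<O>\<close>, and that \<open>g P \<subseteq> P\<close> is impossible, because it
  would make some \<open>g ^ j - g ^ i\<close> and therefore \<open>g\<close> integral. An element \<open>\<pi> \<in> P\<close> with \<open>g * \<pi> \<notin> P\<close>
  generates \<open>P\<close> locally.

  The Galois extension exists because embeddings of subfields into an algebraically closed field
  extend along algebraic elements and permute the roots of rational polynomials.
\<close>

section \<open>Subfields and number fields\<close>

text \<open>Closure under inverses is asked of \<open>0\<close> as well, which is harmless because
  \<open>inverse 0 = 0\<close>. The library's notion is matched by
  \<open>subfield_type_algebra_iff\<close>.\<close>

definition is_subfield :: "'a::field set \<Rightarrow> bool" where
  "is_subfield F \<longleftrightarrow> 1 \<in> F \<and> (\<forall>x\<in>F. \<forall>y\<in>F. x + y \<in> F \<and> x * y \<in> F) \<and>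
     (\<forall>x\<in>F. - x \<in> F \<and> inverse x \<in> F)"

lemma is_subfieldI:
  assumes "1 \<in> F" "\<And>x y. x \<in> F \<Longrightarrow> y \<in> F \<Longrightarrow> x + y \<in> F" "\<And>x y. x \<in> F \<Longrightarrow> y \<in> F \<Longrightarrow> x * y \<in> F"
    "\<And>x. x \<in> F \<Longrightarrow> - x \<in> F" "\<And>x. x \<in> F \<Longrightarrow> x \<noteq> 0 \<Longrightarrow> inverse x \<in> F"
  shows "is_subfield F"
  unfolding is_subfield_def
  by (metis assms inverse_zero)

context
  fixes F :: "'a::field set"
  assumes F: "is_subfield F"
begin

lemma is_subfield_one: "1 \<in> F" and is_subfield_add: "x \<in> F \<Longrightarrow> y \<in> F \<Longrightarrow> x + y \<in> F"
  and is_subfield_mult: "x \<in> F \<Longrightarrow> y \<in> F \<Longrightarrow> x * y \<in> F"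
  and is_subfield_uminus: "x \<in> F \<Longrightarrow> - x \<in> F" and is_subfield_inverse: "x \<in> F \<Longrightarrow> inverse x \<in> F"
  using F by (auto simp: is_subfield_def)

lemma is_subfield_zero: "0 \<in> F"
  using is_subfield_add[OF is_subfield_one is_subfield_uminus[OF is_subfield_one]] by simp

lemma is_subfield_diff: "x \<in> F \<Longrightarrow> y \<in> F \<Longrightarrow> x - y \<in> F"
  using is_subfield_add[OF _ is_subfield_uminus] by fastforce

lemma is_subfield_divide: "x \<in> F \<Longrightarrow> y \<in> F \<Longrightarrow> x / y \<in> F"
  by (simp add: divide_inverse is_subfield_mult is_subfield_inverse)

lemma is_subfield_power: "x \<in> F \<Longrightarrow> x ^ n \<in> F"
  by (induction n) (auto intro: is_subfield_mult is_subfield_one)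

lemma is_subfield_sum: "(\<And>i. i \<in> A \<Longrightarrow> f i \<in> F) \<Longrightarrow> sum f A \<in> F"
  by (induction A rule: infinite_finite_induct) (auto intro: is_subfield_add is_subfield_zero)

lemma is_subfield_of_nat: "of_nat n \<in> F"
  by (induction n) (auto intro: is_subfield_add is_subfield_one is_subfield_zero)

lemma is_subfield_of_int: "of_int n \<in> F"
  by (cases n) (auto intro: is_subfield_of_nat is_subfield_uminus simp del: of_nat_Suc)

end

lemma is_subfield_Rats_subset:
  assumes "is_subfield (F :: 'a::field_char_0 set)" shows "\<rat> \<subseteq> F"
  by (auto elim!: Rats_cases' intro!: is_subfield_divide is_subfield_of_int assms)

lemma is_subfield_Rats: "is_subfield (\<rat> :: 'a::field_char_0 set)"
  by (intro is_subfieldI) auto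

section \<open>Arithmetic of the bundled ring in type class terms\<close>

lemma type_algebra_simps [simp]:
  fixes x y :: "'a::ring_1"
  shows "carrier (ring_of_type_algebra :: 'a ring) = UNIV" "x \<otimes>\<^bsub>ring_of_type_algebra\<^esub> y = x * y"
    "\<one>\<^bsub>ring_of_type_algebra\<^esub> = (1::'a)" "\<zero>\<^bsub>ring_of_type_algebra\<^esub> = (0::'a)"
    "x \<oplus>\<^bsub>ring_of_type_algebra\<^esub> y = x + y"
  by (simp_all add: ring_of_type_algebra_def)

lemma type_algebra_a_inv [simp]: "\<ominus>\<^bsub>ring_of_type_algebra\<^esub> x = - (x :: 'a::comm_ring_1)"
proof -
  interpret ring "ring_of_type_algebra :: 'a ring" by rule
  have "x + \<ominus>\<^bsub>ring_of_type_algebra\<^esub> x = 0"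
    using r_neg[of x] by simp
  then show ?thesis
    by (simp add: add_eq_0_iff)
qed

lemma type_algebra_pow [simp]: "x [^]\<^bsub>ring_of_type_algebra\<^esub> (n::nat) = (x :: 'a::comm_ring_1) ^ n"
proof -
  interpret ring "ring_of_type_algebra :: 'a ring" by rule
  show ?thesis by (induction n) (auto simp: nat_pow_Suc mult.commute)
qed

lemma type_algebra_m_inv:
  assumes "x \<noteq> 0" shows "inv\<^bsub>ring_of_type_algebra\<^esub> x = inverse (x :: 'a::field)"
proof -
  interpret field "ring_of_type_algebra :: 'a ring" by rule
  have "x \<in> Units ring_of_type_algebra"
    using assms by (simp add: field_Units)
  then have "x * inv\<^bsub>ring_of_type_algebra\<^esub> x = 1"
    using Units_r_inv by fastforce
  then show ?thesis
    using inverse_unique by metis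
qed

lemma subring_type_algebraD:
  assumes "subring F (ring_of_type_algebra :: 'a::field ring)"
  shows "0 \<in> F" "1 \<in> F" "x \<in> F \<Longrightarrow> y \<in> F \<Longrightarrow> x + y \<in> F" "x \<in> F \<Longrightarrow> y \<in> F \<Longrightarrow> x * y \<in> F"
    "x \<in> F \<Longrightarrow> - x \<in> F"
  using subringE[OF assms] by auto

lemma subfield_type_algebra_iff:
  "subfield F (ring_of_type_algebra :: 'a::field ring) \<longleftrightarrow> is_subfield F"
proof -
  interpret field "ring_of_type_algebra :: 'a ring" by rule
  show ?thesis
  proof
    assume S: "subfield F ring_of_type_algebra"
    note D = subring_type_algebraD[OF subfieldE(1)[OF S]]
    have "inverse x \<in> F" if "x \<in> F" "x \<noteq> 0" for x
      using subfield_m_inv(1)[OF S, of x] that by (auto simp: type_algebra_m_inv)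
    then show "is_subfield F"
      by (intro is_subfieldI) (auto intro: D)
  next
    assume "is_subfield F"
    then show "subfield F ring_of_type_algebra"
      by (intro subfieldI' subringI)
        (auto simp: is_subfield_one is_subfield_add is_subfield_mult is_subfield_uminus
              type_algebra_m_inv is_subfield_inverse)
  qed
qed

lemma number_field_is_subfield: "number_field K \<Longrightarrow> is_subfield K"
  by (simp add: number_field_def subfield_type_algebra_iff)

text \<open>Polynomials of the bundled ring are lists with the leading coefficient first, whereas
  \<open>Poly\<close> expects the constant coefficient first; hence the reversal.\<close>

lemma type_algebra_eval:
  "ring.eval (ring_of_type_algebra :: 'a::field ring) p x = poly (Poly (rev p)) x"
proof -
  interpret field "ring_of_type_algebra :: 'a ring" by rule
  show ?thesis
    by (induction p) (auto simp: Poly_append poly_monom)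
qed

text \<open>Both sides ask for a nonzero rational polynomial vanishing at \<open>x\<close>; only the
  representation changes. This links the library's finite extensions to type class
  polynomials.\<close>

lemma algebraic_over_Rats_iff:
  fixes x :: "'a::field_char_0"
  shows "(ring.algebraic ring_of_type_algebra over \<rat>) x \<longleftrightarrow> Polynomial.algebraic x"
proof -
  interpret field "ring_of_type_algebra :: 'a ring" by rule
  have sub: "subfield \<rat> (ring_of_type_algebra :: 'a ring)"
    by (simp add: subfield_type_algebra_iff is_subfield_Rats)
  show ?thesis
  proof
    assume "(ring.algebraic ring_of_type_algebra over \<rat>) x"
    then obtain p where p: "p \<in> carrier (\<rat> [X]\<^bsub>ring_of_type_algebra\<^esub>)" "p \<noteq> []" "eval p x = 0"
      using algebraicE[OF subfieldE(1)[OF sub], of x] by auto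
    have p': "set p \<subseteq> \<rat>" "hd p \<noteq> 0"
      using p by (auto simp: univ_poly_def polynomial_def)
    have "Polynomial.coeff (Poly (rev p)) (length p - 1) = hd p"
      using p by (auto simp: nth_default_def rev_nth hd_conv_nth)
    then have "Poly (rev p) \<noteq> 0"
      using p' by (metis coeff_0)
    moreover have "Polynomial.coeff (Poly (rev p)) i \<in> \<rat>" for i
      using p'(1) nth_mem[of i "rev p"] by (auto simp: nth_default_def simp del: nth_mem)
    ultimately show "Polynomial.algebraic x"
      using p(3) unfolding algebraic_altdef type_algebra_eval by blast
  next
    assume "Polynomial.algebraic x"
    then obtain p where p: "\<forall>i. Polynomial.coeff p i \<in> \<rat>" "p \<noteq> 0" "poly p x = 0"
      by (auto simp: algebraic_altdef)
    show "(ring.algebraic ring_of_type_algebra over \<rat>) x"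
    proof (rule algebraicI[of "rev (coeffs p)"])
      show "rev (coeffs p) \<in> carrier (\<rat> [X]\<^bsub>ring_of_type_algebra\<^esub>)"
        using p by (auto simp: univ_poly_def polynomial_def hd_rev last_coeffs_eq_coeff_degree
            in_set_conv_nth coeffs_nth length_coeffs_degree less_Suc_eq_le)
      show "rev (coeffs p) \<noteq> []" using p by simp
      show "eval (rev (coeffs p)) x = \<zero>\<^bsub>ring_of_type_algebra\<^esub>"
        using p by (simp add: type_algebra_eval)
    qed
  qed
qed

lemma number_field_algebraic:
  assumes "number_field K" "x \<in> K" shows "Polynomial.algebraic x"
proof -
  interpret field "ring_of_type_algebra :: 'a ring" by rule
  have sub: "subfield \<rat> (ring_of_type_algebra :: 'a ring)"
    by (simp add: subfield_type_algebra_iff is_subfield_Rats)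
  have "subring K ring_of_type_algebra" "finite_dimension \<rat> K"
    using assms subfieldE(1) by (auto simp: number_field_def)
  from finite_dimension_imp_algebraic[OF sub this assms(2)] show ?thesis
    by (simp add: algebraic_over_Rats_iff)
qed

section \<open>Number fields as rational vector spaces\<close>

definition rat_scale :: "rat \<Rightarrow> 'a \<Rightarrow> 'a::field_char_0" where
  "rat_scale r x = of_rat r * x"

interpretation rat_vs: vector_space rat_scale
  by unfold_locales (auto simp: rat_scale_def algebra_simps of_rat_add of_rat_mult)

lemma number_field_finite_span:
  assumes "number_field (K :: 'a::field_char_0 set)"
  obtains B where "finite B" "B \<subseteq> K" "K \<subseteq> rat_vs.span B"
proof -
  interpret field "ring_of_type_algebra :: 'a ring" by rule
  have sub: "subfield \<rat> (ring_of_type_algebra :: 'a ring)"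
    by (simp add: subfield_type_algebra_iff is_subfield_Rats)
  obtain n where "dimension n \<rat> K"
    using assms by (auto simp: number_field_def finite_dimension_def)
  from exists_base[OF sub this] obtain Us where Us: "Span \<rat> Us = K"
    by blast
  have comb: "combine Ks Vs \<in> rat_vs.span (set Vs)" if "set Ks \<subseteq> \<rat>" for Ks Vs :: "'a list"
    using that
  proof (induction Ks Vs rule: combine.induct)
    case (1 k Ks v Vs)
    obtain r where r: "k = of_rat r" using 1 by (auto elim: Rats_cases)
    have "combine Ks Vs \<in> rat_vs.span (set (v # Vs))"
      using 1 rat_vs.span_mono[of "set Vs" "set (v # Vs)"] by auto
    moreover have "k * v \<in> rat_vs.span (set (v # Vs))"
      using rat_vs.span_scale[OF rat_vs.span_base[of v "set (v # Vs)"], of r]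
      by (simp add: rat_scale_def r)
    ultimately show ?case
      using rat_vs.span_add by fastforce
  qed (auto simp: rat_vs.span_zero)
  have "K \<subseteq> rat_vs.span (set Us)"
    unfolding Us[symmetric] using Span_eq_combine_set[OF sub, of Us] comb by (auto simp del: Span.simps)
  moreover have "set Us \<subseteq> K"
    using Span_base_incl[OF sub, of Us] Us by auto
  ultimately show ?thesis
    by (intro that[of "set Us"]) auto
qed

section \<open>Existence of a Galois closure\<close>

text \<open>Embeddings of various subfields share one type: \<open>\<sigma>\<close> is total, and
  its values outside \<open>F\<close> are arbitrary. On a subfield the condition at \<open>1\<close>
  forces injectivity.\<close>

definition hom_on :: "'a::field set \<Rightarrow> ('a \<Rightarrow> 'b::field) \<Rightarrow> bool" where
  "hom_on F \<sigma> \<longleftrightarrow> \<sigma> 1 = 1 \<and> (\<forall>x\<in>F. \<forall>y\<in>F. \<sigma> (x + y) = \<sigma> x + \<sigma> y \<and> \<sigma> (x * y) = \<sigma> x * \<sigma> y)"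

section \<open>Polynomials over a subfield and their images under embeddings\<close>

definition poly_over :: "'a::field set \<Rightarrow> 'a poly set" where
  "poly_over F = {p. \<forall>i. Polynomial.coeff p i \<in> F}"

context
  fixes F :: "'a::field set"
  assumes F: "is_subfield F"
begin

lemma poly_over_zero: "0 \<in> poly_over F"
  by (simp add: poly_over_def is_subfield_zero[OF F])

lemma poly_over_diff: "p \<in> poly_over F \<Longrightarrow> r \<in> poly_over F \<Longrightarrow> p - r \<in> poly_over F"
  by (simp add: poly_over_def is_subfield_diff[OF F])

lemma poly_over_add: "p \<in> poly_over F \<Longrightarrow> r \<in> poly_over F \<Longrightarrow> p + r \<in> poly_over F"
  by (simp add: poly_over_def is_subfield_add[OF F])

lemma poly_over_mult: "p \<in> poly_over F \<Longrightarrow> r \<in> poly_over F \<Longrightarrow> p * r \<in> poly_over F"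
  by (simp add: poly_over_def coeff_mult is_subfield_sum[OF F] is_subfield_mult[OF F])

lemma poly_over_monom: "c \<in> F \<Longrightarrow> Polynomial.monom c n \<in> poly_over F"
  by (simp add: poly_over_def is_subfield_zero[OF F])

lemma poly_over_pCons: "c \<in> F \<Longrightarrow> p \<in> poly_over F \<Longrightarrow> pCons c p \<in> poly_over F"
  by (auto simp: poly_over_def coeff_pCons split: nat.splits)

text \<open>A simple extension is generated by Horner steps \<open>k1 * z + k2\<close>, and each of
  them is a \<open>pCons\<close>.\<close>

lemma poly_over_simple_extension:
  assumes "y \<in> ring.simple_extension ring_of_type_algebra F z"
  shows "\<exists>p\<in>poly_over F. y = poly p z"
proof -
  interpret field "ring_of_type_algebra :: 'a ring" by rule
  from assms show ?thesis
  proof (induction rule: simple_extension.induct)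
    case zero
    show ?case using poly_over_zero by (intro bexI[of _ 0]) auto
  next
    case (lin k1 k2)
    then obtain p where "p \<in> poly_over F" "k1 = poly p z" by blast
    with lin(2) show ?case
      by (intro bexI[of _ "pCons k2 p"]) (auto intro: poly_over_pCons simp: algebra_simps)
  qed
qed

context
  fixes \<sigma> :: "'a \<Rightarrow> 'b::field"
  assumes \<sigma>: "hom_on F \<sigma>"
begin

lemma hom_on_one: "\<sigma> 1 = 1" and hom_on_add: "x \<in> F \<Longrightarrow> y \<in> F \<Longrightarrow> \<sigma> (x + y) = \<sigma> x + \<sigma> y"
  and hom_on_mult: "x \<in> F \<Longrightarrow> y \<in> F \<Longrightarrow> \<sigma> (x * y) = \<sigma> x * \<sigma> y"
  using \<sigma> by (auto simp: hom_on_def)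

lemma hom_on_zero: "\<sigma> 0 = 0"
  using hom_on_add[of 0 0] is_subfield_zero[OF F] by (metis add.right_neutral add_left_cancel)

lemma hom_on_uminus: "x \<in> F \<Longrightarrow> \<sigma> (- x) = - \<sigma> x"
  using hom_on_add[of x "- x"] is_subfield_uminus[OF F] by (simp add: hom_on_zero add_eq_0_iff)

lemma hom_on_diff: "x \<in> F \<Longrightarrow> y \<in> F \<Longrightarrow> \<sigma> (x - y) = \<sigma> x - \<sigma> y"
  using hom_on_add[of x "- y"] by (simp add: hom_on_uminus is_subfield_uminus[OF F])

lemma hom_on_inverse: "x \<in> F \<Longrightarrow> \<sigma> (inverse x) = inverse (\<sigma> x)"
proof (cases "x = 0")
  case False
  assume "x \<in> F"
  then have "\<sigma> x * \<sigma> (inverse x) = 1"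
    using hom_on_mult[of x "inverse x"] is_subfield_inverse[OF F] False by (simp add: hom_on_one)
  then show ?thesis by (metis inverse_unique)
qed (simp add: hom_on_zero)

lemma hom_on_eq_0_iff: "x \<in> F \<Longrightarrow> \<sigma> x = 0 \<longleftrightarrow> x = 0"
  using hom_on_mult[of x "inverse x"] is_subfield_inverse[OF F, of x]
  by (cases "x = 0") (auto simp: hom_on_zero hom_on_one)

lemma hom_on_sum: "(\<And>i. i \<in> A \<Longrightarrow> f i \<in> F) \<Longrightarrow> \<sigma> (sum f A) = (\<Sum>i\<in>A. \<sigma> (f i))"
  by (induction A rule: infinite_finite_induct)
    (auto simp: hom_on_zero hom_on_add is_subfield_sum[OF F])

lemma hom_on_power: "x \<in> F \<Longrightarrow> \<sigma> (x ^ n) = \<sigma> x ^ n"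
  by (induction n) (auto simp: hom_on_one hom_on_mult is_subfield_power[OF F])

lemma hom_on_of_nat: "\<sigma> (of_nat n) = of_nat n"
  by (induction n) (auto simp: hom_on_zero hom_on_one hom_on_add is_subfield_one[OF F] is_subfield_of_nat[OF F])

lemma hom_on_of_int: "\<sigma> (of_int n) = of_int n"
  by (cases n) (auto simp: hom_on_of_nat hom_on_uminus is_subfield_of_nat[OF F] simp del: of_nat_Suc)

lemma coeff_map_hom: "Polynomial.coeff (map_poly \<sigma> p) i = \<sigma> (Polynomial.coeff p i)"
  by (simp add: coeff_map_poly hom_on_zero)

lemma map_poly_hom_add:
  "p \<in> poly_over F \<Longrightarrow> r \<in> poly_over F \<Longrightarrow> map_poly \<sigma> (p + r) = map_poly \<sigma> p + map_poly \<sigma> r"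
  by (rule poly_eqI) (simp add: coeff_map_hom poly_over_def hom_on_add)

lemma map_poly_hom_diff:
  "p \<in> poly_over F \<Longrightarrow> r \<in> poly_over F \<Longrightarrow> map_poly \<sigma> (p - r) = map_poly \<sigma> p - map_poly \<sigma> r"
  by (rule poly_eqI) (simp add: coeff_map_hom poly_over_def hom_on_diff)

lemma map_poly_hom_mult:
  "p \<in> poly_over F \<Longrightarrow> r \<in> poly_over F \<Longrightarrow> map_poly \<sigma> (p * r) = map_poly \<sigma> p * map_poly \<sigma> r"
  by (rule poly_eqI)
    (simp add: coeff_map_hom poly_over_def coeff_mult hom_on_sum hom_on_mult is_subfield_mult[OF F])

text \<open>An embedding of a field is injective, so the leading coefficient does not
  vanish.\<close>

lemma degree_map_hom: "p \<in> poly_over F \<Longrightarrow> Polynomial.degree (map_poly \<sigma> p) = Polynomial.degree p"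
proof (cases "p = 0")
  case False
  assume p: "p \<in> poly_over F"
  show ?thesis
  proof (rule antisym)
    show "Polynomial.degree (map_poly \<sigma> p) \<le> Polynomial.degree p"
      by (rule degree_le) (simp add: coeff_map_hom hom_on_zero coeff_eq_0)
    show "Polynomial.degree p \<le> Polynomial.degree (map_poly \<sigma> p)"
      using p False by (intro le_degree) (simp add: coeff_map_hom hom_on_eq_0_iff poly_over_def)
  qed
qed simp

lemma poly_map_hom:
  assumes "p \<in> poly_over F" "x \<in> F"
  shows "poly (map_poly \<sigma> p) (\<sigma> x) = \<sigma> (poly p x)"
  unfolding poly_altdef degree_map_hom[OF assms(1)] using assms
  by (simp add: coeff_map_hom poly_over_def hom_on_sum hom_on_mult hom_on_power
      is_subfield_power[OF F] is_subfield_mult[OF F])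

end

end

lemma hom_on_of_rat:
  fixes F :: "'a::field_char_0 set" and \<sigma> :: "'a \<Rightarrow> 'b::field_char_0"
  assumes "is_subfield F" "hom_on F \<sigma>"
  shows "\<sigma> (of_rat r) = of_rat r"
proof -
  obtain a b where r: "r = of_int a / of_int b" by (metis quotient_of_div surj_pair)
  have *: "(of_rat r :: 'c::field_char_0) = of_int a * inverse (of_int b)"
    by (simp add: r divide_inverse of_rat_mult of_rat_inverse)
  show ?thesis
    unfolding * using assms
    by (simp add: hom_on_mult hom_on_inverse hom_on_of_int is_subfield_of_int is_subfield_inverse)
qed

lemma hom_on_of_rat_poly:
  fixes F :: "'a::field_char_0 set" and \<sigma> :: "'a \<Rightarrow> 'b::field_char_0"
  assumes "is_subfield F" "hom_on F \<sigma>"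
  shows "map_poly \<sigma> (map_poly of_rat p) = map_poly of_rat p"
  by (rule poly_eqI) (simp add: coeff_map_poly hom_on_zero[OF assms] hom_on_of_rat[OF assms])

lemma is_subfield_UNIV: "is_subfield UNIV"
  by (simp add: is_subfield_def)

text \<open>Turns the facts about \<open>map_poly\<close> under embeddings into facts about
  \<open>map_poly of_rat\<close>.\<close>

lemma hom_on_rat: "hom_on UNIV (of_rat :: rat \<Rightarrow> 'a::field_char_0)"
  by (simp add: hom_on_def of_rat_add of_rat_mult)

lemma poly_over_UNIV: "p \<in> poly_over UNIV"
  by (simp add: poly_over_def)

lemma of_rat_poly_over:
  assumes "is_subfield (F :: 'a::field_char_0 set)"
  shows "map_poly of_rat p \<in> poly_over F"
  using is_subfield_Rats_subset[OF assms] by (auto simp: poly_over_def coeff_map_poly)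

lemmas of_rat_poly_mult = map_poly_hom_mult[OF is_subfield_UNIV hom_on_rat poly_over_UNIV poly_over_UNIV]
lemmas of_rat_poly_add = map_poly_hom_add[OF is_subfield_UNIV hom_on_rat poly_over_UNIV poly_over_UNIV]
lemmas degree_of_rat_poly = degree_map_hom[OF is_subfield_UNIV hom_on_rat poly_over_UNIV]

section \<open>Adjoining algebraic elements and extending embeddings\<close>

lemma simple_extension_algebraic:
  fixes F :: "'a::field_char_0 set"
  assumes "is_subfield F" "Polynomial.algebraic z"
  shows "is_subfield (ring.simple_extension ring_of_type_algebra F z)"
    "F \<subseteq> ring.simple_extension ring_of_type_algebra F z"
    "z \<in> ring.simple_extension ring_of_type_algebra F z"
proof -
  interpret field "ring_of_type_algebra :: 'a ring" by rule
  have sub: "subfield F ring_of_type_algebra" using assms by (simp add: subfield_type_algebra_iff)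
  have "(ring.algebraic ring_of_type_algebra over F) z"
    using assms algebraic_mono[OF is_subfield_Rats_subset[OF assms(1)]]
    by (simp add: algebraic_over_Rats_iff)
  then show "is_subfield (simple_extension F z)"
    using simple_extension_is_subfield[OF sub, of z] by (simp add: subfield_type_algebra_iff)
  show "F \<subseteq> simple_extension F z" by (rule simple_extension_incl) auto
  show "z \<in> simple_extension F z" using subfieldE(1)[OF sub] by (rule simple_extension_mem) simp
qed

text \<open>The extension sends \<open>poly p z\<close> to
  \<open>poly (map_poly \<sigma> p) z'\<close>. The choice of \<open>p\<close> does not matter: two
  choices differ by a polynomial vanishing at \<open>z\<close>, whose image vanishes at
  \<open>z'\<close> by assumption.\<close>

lemma hom_extension_to:
  fixes F :: "'a::field_char_0 set" and \<sigma> :: "'a \<Rightarrow> 'b::field_char_0"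
  assumes F: "is_subfield F" and \<sigma>: "hom_on F \<sigma>" and z: "Polynomial.algebraic z"
    and z': "\<And>p. p \<in> poly_over F \<Longrightarrow> poly p z = 0 \<Longrightarrow> poly (map_poly \<sigma> p) z' = 0"
  obtains F' \<sigma>' where "is_subfield F'" "F \<subseteq> F'" "z \<in> F'" "hom_on F' \<sigma>'"
    "\<And>x. x \<in> F \<Longrightarrow> \<sigma>' x = \<sigma> x" "\<sigma>' z = z'"
proof -
  define F' where "F' = ring.simple_extension ring_of_type_algebra F z"
  note F' = simple_extension_algebraic[OF F z, folded F'_def]
  define \<sigma>' where "\<sigma>' y = poly (map_poly \<sigma> (SOME p. p \<in> poly_over F \<and> y = poly p z)) z'" for y
  have \<sigma>': "\<sigma>' (poly p z) = poly (map_poly \<sigma> p) z'" if p: "p \<in> poly_over F" for p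
  proof -
    define r where "r = (SOME r. r \<in> poly_over F \<and> poly p z = poly r z)"
    have r: "r \<in> poly_over F \<and> poly p z = poly r z"
      unfolding r_def by (rule someI[of _ p]) (use p in auto)
    then have "poly (map_poly \<sigma> (p - r)) z' = 0"
      using p by (intro z') (auto intro: poly_over_diff[OF F])
    then have "poly (map_poly \<sigma> p) z' = poly (map_poly \<sigma> r) z'"
      using p r by (simp add: map_poly_hom_diff[OF F \<sigma>])
    then show ?thesis by (simp add: \<sigma>'_def r_def)
  qed
  have const: "[:x:] \<in> poly_over F" if "x \<in> F" for x
    using poly_over_pCons[OF F that poly_over_zero[OF F]] .
  have ext: "\<sigma>' x = \<sigma> x" if "x \<in> F" for x
    using \<sigma>'[OF const[OF that]] by (simp add: map_poly_pCons hom_on_zero[OF F \<sigma>])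
  have "hom_on F' \<sigma>'"
    unfolding hom_on_def
  proof (intro conjI ballI)
    show "\<sigma>' 1 = 1" using ext[of 1] is_subfield_one[OF F] hom_on_one[OF F \<sigma>] by simp
    fix x y assume "x \<in> F'" "y \<in> F'"
    then obtain p r where p: "p \<in> poly_over F" "x = poly p z" and r: "r \<in> poly_over F" "y = poly r z"
      unfolding F'_def using poly_over_simple_extension[OF F] by metis
    show "\<sigma>' (x + y) = \<sigma>' x + \<sigma>' y"
      using \<sigma>'[OF poly_over_add[OF F p(1) r(1)]] \<sigma>'[OF p(1)] \<sigma>'[OF r(1)]
      by (simp add: p(2) r(2) map_poly_hom_add[OF F \<sigma> p(1) r(1)])
    show "\<sigma>' (x * y) = \<sigma>' x * \<sigma>' y"
      using \<sigma>'[OF poly_over_mult[OF F p(1) r(1)]] \<sigma>'[OF p(1)] \<sigma>'[OF r(1)]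
      by (simp add: p(2) r(2) map_poly_hom_mult[OF F \<sigma> p(1) r(1)])
  qed
  moreover have "\<sigma>' z = z'"
  proof -
    have "[:0, 1:] \<in> poly_over F"
      by (intro poly_over_pCons[OF F] const is_subfield_one[OF F] is_subfield_zero[OF F])
    from \<sigma>'[OF this] show ?thesis
      by (simp add: map_poly_pCons hom_on_zero[OF F \<sigma>] hom_on_one[OF F \<sigma>])
  qed
  ultimately show ?thesis using that F' ext by blast
qed

text \<open>Take for \<open>z'\<close> a root of the image of a minimal polynomial \<open>m\<close>
  of \<open>z\<close> over \<open>F\<close>. Every \<open>p\<close> vanishing at \<open>z\<close>
  reduces to zero by subtracting multiples of \<open>m\<close>.\<close>

lemma ex_conjugate:
  fixes F :: "'a::field_char_0 set" and \<sigma> :: "'a \<Rightarrow> 'b::{alg_closed_field, field_char_0}"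
  assumes F: "is_subfield F" and \<sigma>: "hom_on F \<sigma>" and z: "Polynomial.algebraic z"
  obtains z' where "\<And>p. p \<in> poly_over F \<Longrightarrow> poly p z = 0 \<Longrightarrow> poly (map_poly \<sigma> p) z' = 0"
proof -
  let ?A = "\<lambda>p. p \<in> poly_over F \<and> p \<noteq> 0 \<and> poly p z = 0"
  have "\<exists>p. ?A p"
    using z is_subfield_Rats_subset[OF F] unfolding algebraic_altdef poly_over_def by blast
  then obtain m where m: "m \<in> poly_over F" "m \<noteq> 0" "poly m z = 0"
    and min: "\<And>p. p \<in> poly_over F \<Longrightarrow> p \<noteq> 0 \<Longrightarrow> poly p z = 0 \<Longrightarrow>
      Polynomial.degree m \<le> Polynomial.degree p"
    using ex_has_least_nat[of ?A _ Polynomial.degree] by metis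
  have "Polynomial.degree m > 0"
    using m by (intro Nat.gr0I) (auto elim!: degree_eq_zeroE)
  then obtain z' where root: "poly (map_poly \<sigma> m) z' = 0"
    using alg_closed_imp_poly_has_root[of "map_poly \<sigma> m"] degree_map_hom[OF F \<sigma> m(1)] by auto
  have "poly (map_poly \<sigma> p) z' = 0" if "p \<in> poly_over F" "poly p z = 0" for p
    using that
  proof (induction "Polynomial.degree p" arbitrary: p rule: less_induct)
    case less
    show ?case
    proof (cases "p = 0")
      case True
      then show ?thesis by simp
    next
      case False
      have le: "Polynomial.degree m \<le> Polynomial.degree p" using min less.prems False by blast
      \<comment> \<open>One step of long division, carried out explicitly to see that the
        coefficients stay in \<open>F\<close>: \<open>e * m\<close> has the degree and the leading
        coefficient of \<open>p\<close>.\<close>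
      define c where "c = lead_coeff p / lead_coeff m"
      define e where "e = Polynomial.monom c (Polynomial.degree p - Polynomial.degree m)"
      have "c \<in> F" using m less.prems by (auto simp: c_def poly_over_def intro!: is_subfield_divide[OF F])
      then have e: "e \<in> poly_over F" by (simp add: e_def poly_over_monom[OF F])
      have c0: "c \<noteq> 0" using False m by (simp add: c_def)
      have em: "e * m \<in> poly_over F" using poly_over_mult[OF F e m(1)] .
      have degem: "Polynomial.degree (e * m) = Polynomial.degree p"
        using le c0 m by (simp add: e_def degree_mult_eq degree_monom_eq monom_eq_0_iff)
      have lc: "lead_coeff (e * m) = lead_coeff p"
        using m by (simp only: lead_coeff_mult)
          (simp add: e_def degree_monom_eq c0 c_def[symmetric], simp add: c_def)
      have "poly (map_poly \<sigma> (p - e * m)) z' = 0"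
      proof (cases "p - e * m = 0")
        case False
        have "Polynomial.degree (p - e * m) < Polynomial.degree p"
        proof (rule ccontr)
          assume "\<not> Polynomial.degree (p - e * m) < Polynomial.degree p"
          moreover have "Polynomial.degree (p - e * m) \<le> Polynomial.degree p"
            using degree_diff_le[of p "Polynomial.degree p" "e * m"] degem by simp
          ultimately have "Polynomial.degree (p - e * m) = Polynomial.degree p" by simp
          moreover have "Polynomial.coeff (p - e * m) (Polynomial.degree p) = 0" using lc degem by simp
          ultimately show False using False leading_coeff_0_iff[of "p - e * m"] by metis
        qed
        then show ?thesis
          using less.hyps poly_over_diff[OF F less.prems(1) em] less.prems(2) m(3) by simp
      qed simp
      then show ?thesis
        by (simp add: map_poly_hom_diff[OF F \<sigma> less.prems(1) em] map_poly_hom_mult[OF F \<sigma> e m(1)] root)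
    qed
  qed
  then show ?thesis by (rule that)
qed

text \<open>The elements of \<open>A\<close> are adjoined one at a time; the algebraically closed
  target supplies a conjugate for each.\<close>

lemma hom_extension:
  fixes F :: "'a::field_char_0 set" and \<sigma> :: "'a \<Rightarrow> 'b::{alg_closed_field, field_char_0}"
  assumes "finite A" "\<And>z. z \<in> A \<Longrightarrow> Polynomial.algebraic z" "is_subfield F" "hom_on F \<sigma>"
  shows "\<exists>F' \<sigma>'. is_subfield F' \<and> F \<subseteq> F' \<and> A \<subseteq> F' \<and> hom_on F' \<sigma>' \<and> (\<forall>x\<in>F. \<sigma>' x = \<sigma> x)"
  using assms(1,2)
proof (induction A rule: finite_induct)
  case empty
  show ?case using assms by blast
next
  case (insert z A)
  then obtain F' \<sigma>' where F': "is_subfield F'" "F \<subseteq> F'" "A \<subseteq> F'" "hom_on F' \<sigma>'" "\<forall>x\<in>F. \<sigma>' x = \<sigma> x"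
    by auto
  have z: "Polynomial.algebraic z" using insert by simp
  obtain z' where z': "\<And>p. p \<in> poly_over F' \<Longrightarrow> poly p z = 0 \<Longrightarrow> poly (map_poly \<sigma>' p) z' = 0"
    using ex_conjugate[OF F'(1,4) z] by blast
  obtain F'' \<sigma>'' where "is_subfield F''" "F' \<subseteq> F''" "z \<in> F''" "hom_on F'' \<sigma>''"
    "\<And>x. x \<in> F' \<Longrightarrow> \<sigma>'' x = \<sigma>' x"
    using hom_extension_to[OF F'(1,4) z z'] by metis
  with F' show ?case by (intro exI[of _ F''] exI[of _ \<sigma>'']) auto
qed

text \<open>A rational polynomial \<open>m\<close> of least degree vanishing at \<open>x\<close>
  divides all others, \<open>f\<close> among them. It is not constant, so irreducibility gives
  \<open>f dvd m\<close>.\<close>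

lemma irreducible_root_dvd:
  fixes x :: "'a::field_char_0" and f p :: "rat poly"
  assumes f: "Factorial_Ring.irreducible f" and x: "poly (map_poly of_rat f) x = 0"
    and p: "poly (map_poly of_rat p) x = 0"
  shows "f dvd p"
proof -
  let ?A = "\<lambda>p :: rat poly. p \<noteq> 0 \<and> poly (map_poly of_rat p) x = 0"
  have "?A f" using f x by auto
  then obtain m where m: "m \<noteq> 0" "poly (map_poly of_rat m) x = 0"
    and min: "\<And>p. ?A p \<Longrightarrow> Polynomial.degree m \<le> Polynomial.degree p"
    using ex_has_least_nat[of ?A f Polynomial.degree] by blast
  have dvd: "m dvd p" if "poly (map_poly of_rat p) x = 0" for p :: "rat poly"
  proof (rule ccontr)
    assume "\<not> m dvd p"
    then have r: "p mod m \<noteq> 0" by (simp add: mod_eq_0_iff_dvd)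
    have "map_poly of_rat p = (map_poly of_rat (p div m * m + p mod m) :: 'a poly)" by simp
    also have "\<dots> = map_poly of_rat (p div m) * map_poly of_rat m + map_poly of_rat (p mod m)"
      by (simp only: of_rat_poly_add of_rat_poly_mult)
    finally have "poly (map_poly of_rat (p mod m)) x = 0" using that m by simp
    then have "Polynomial.degree m \<le> Polynomial.degree (p mod m)" using min r by blast
    then show False using degree_mod_less[OF m(1), of p] r by auto
  qed
  have "\<not> is_unit m"
    using m by (auto simp: is_unit_poly_iff map_poly_pCons)
  then have "f dvd m" using irreducibleD'[OF f dvd[OF x]] by blast
  with dvd[OF p] show ?thesis by (rule dvd_trans[rotated])
qed

lemma size_proots_alg_closed:
  "size (proots (p :: 'a::alg_closed_field poly)) = Polynomial.degree p"
proof (cases "p = 0")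
  case False
  obtain A where A: "size A = Polynomial.degree p" "p = smult (lead_coeff p) (\<Prod>x\<in>#A. [:-x, 1:])"
    using alg_closed_imp_factorization[OF False] by blast
  have nz: "(\<Prod>x\<in>#B. [:-x, 1:]) \<noteq> 0" for B :: "'a multiset"
    by (auto simp: prod_mset_zero_iff)
  have "proots p = proots (\<Prod>x\<in>#A. [:-x, 1:])" using False by (subst A(2)) simp
  also have "\<dots> = A" proof (induction A)
    case (add x A)
    then show ?case using proots_mult[of "[:-x, 1:]" "\<Prod>x\<in>#A. [:-x, 1:]"] nz by simp
  qed simp
  finally show ?thesis using A by simp
qed simp

text \<open>Separability in characteristic 0: a multiple root would be shared with the derivative,
  so \<open>f\<close> would divide its own derivative, which has smaller degree and is not
  zero.\<close>

lemma card_roots_irreducible: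
  fixes f :: "rat poly"
  assumes f: "Factorial_Ring.irreducible f"
  shows "card {x :: 'a::{alg_closed_field, field_char_0}. poly (map_poly of_rat f) x = 0} =
    Polynomial.degree f"
proof -
  define g :: "'a poly" where "g = map_poly of_rat f"
  have f0: "f \<noteq> 0" using f by auto
  have g0: "g \<noteq> 0" using f0
    by (metis g_def coeff_0 coeff_map_poly leading_coeff_0_iff of_rat_0 of_rat_eq_0_iff)
  have "rsquarefree g"
    unfolding rsquarefree_roots
  proof (intro allI notI)
    fix a assume a: "poly g a = 0 \<and> poly (pderiv g) a = 0"
    have "pderiv g = map_poly of_rat (pderiv f)"
      by (rule poly_eqI) (simp add: g_def coeff_pderiv coeff_map_poly of_rat_mult of_rat_add)
    then have "poly (map_poly of_rat (pderiv f)) a = 0" using a by simp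
    with a have "f dvd pderiv f" unfolding g_def by (intro irreducible_root_dvd[OF f]) auto
    moreover have "Polynomial.degree f > 0"
      using irreducible_not_unit[OF f] is_unit_iff_degree[OF f0] by blast
    ultimately show False using not_dvd_pderiv by blast
  qed
  then have "proots g = mset_set {x. poly g x = 0}"
    using g0 by (intro multiset_eqI) (auto simp: rsquarefree_root_order order_0I count_mset_set' poly_roots_finite)
  then have "card {x. poly g x = 0} = Polynomial.degree g"
    using size_proots_alg_closed[of g] by simp
  then show ?thesis by (simp add: g_def degree_of_rat_poly)
qed

text \<open>\<open>L\<close> is generated by the set \<open>Z\<close> of all roots of rational
  polynomials annihilating the elements of a finite spanning set of \<open>K\<close>. For normality,
  a map sending a root \<open>x\<close> of \<open>f\<close> in \<open>L\<close> to another root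
  \<open>y\<close> extends to an embedding which sends \<open>Z\<close> into \<open>Z\<close>, hence
  \<open>L\<close> into \<open>L\<close>.\<close>

lemma ex_galois_closure:
  fixes K :: "'a::{alg_closed_field, field_char_0} set"
  assumes "number_field K"
  shows "\<exists>L. K \<subseteq> L \<and> galois_over_rat L"
proof -
  interpret field "ring_of_type_algebra :: 'a ring" by rule
  obtain B where B: "finite B" "B \<subseteq> K" "K \<subseteq> rat_vs.span B"
    by (rule number_field_finite_span[OF assms])
  have "\<forall>b\<in>B. \<exists>p :: 'a poly. p \<in> poly_over \<rat> \<and> p \<noteq> 0 \<and> poly p b = 0"
    using number_field_algebraic[OF assms] B(2) unfolding algebraic_altdef poly_over_def by blast
  then obtain p :: "'a \<Rightarrow> 'a poly"
    where p: "\<And>b. b \<in> B \<Longrightarrow> p b \<in> poly_over \<rat> \<and> p b \<noteq> 0 \<and> poly (p b) b = 0"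
    by metis
  define Z where "Z = (\<Union>b\<in>B. {z. poly (p b) z = 0})"
  have finZ: "finite Z" using B(1) p by (auto simp: Z_def intro!: poly_roots_finite)
  have algZ: "Polynomial.algebraic z" if "z \<in> Z" for z
    using that p unfolding Z_def algebraic_altdef poly_over_def by blast
  obtain zs where zs: "set zs = Z" using finite_list[OF finZ] by blast
  have sub: "subfield \<rat> (ring_of_type_algebra :: 'a ring)"
    by (simp add: subfield_type_algebra_iff is_subfield_Rats)
  have alg: "(ring.algebraic ring_of_type_algebra over \<rat>) z" if "z \<in> set zs" for z
    using algZ that zs by (simp add: algebraic_over_Rats_iff)
  define L where "L = finite_extension \<rat> zs"
  have L_sub: "subfield L ring_of_type_algebra"
    unfolding L_def by (rule finite_extension_is_subfield[OF sub _ alg]) auto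
  have L_fin: "finite_dimension \<rat> L"
    unfolding L_def by (rule finite_extension_finite_dimension(1)[OF sub _ alg]) auto
  have nfL: "number_field L" using L_sub L_fin by (simp add: number_field_def)
  have Lf: "is_subfield L" using L_sub by (simp add: subfield_type_algebra_iff)
  have ZL: "Z \<subseteq> L" unfolding L_def zs[symmetric]
    by (rule finite_extension_mem[OF subfieldE(1)[OF sub]]) auto
  \<comment> \<open>\<open>L\<close> is the least subfield containing \<open>Z\<close>.\<close>
  have min: "L \<subseteq> M" if "is_subfield M" "Z \<subseteq> M" for M
    unfolding L_def using that is_subfield_Rats_subset[OF that(1)] zs subfieldE(1)
    by (intro finite_extension_subring_incl) (auto simp flip: subfield_type_algebra_iff)
  have "rat_vs.subspace L"
    using is_subfield_Rats_subset[OF Lf] Lf unfolding rat_vs.subspace_def rat_scale_def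
    by (auto intro!: is_subfield_zero is_subfield_add is_subfield_mult)
  moreover have "B \<subseteq> L" using p ZL by (auto simp: Z_def)
  ultimately have KL: "K \<subseteq> L" using rat_vs.span_minimal B(3) by blast
  have "card {x \<in> L. poly (map_poly of_rat f) x = 0} = Polynomial.degree f"
    if f: "Factorial_Ring.irreducible f" and x: "x \<in> L" "poly (map_poly of_rat f) x = 0"
    for f :: "rat poly" and x
  proof -
    have "y \<in> L" if y: "poly (map_poly of_rat f) y = 0" for y
    proof -
      have id: "hom_on \<rat> (\<lambda>x::'a. x)" by (simp add: hom_on_def)
      \<comment> \<open>Sending \<open>x\<close> to \<open>y\<close> is legitimate because
        \<open>f\<close> divides every rational polynomial that vanishes at \<open>x\<close>. The
        identity is the embedding to be extended.\<close>
      have conj: "poly (map_poly (\<lambda>x. x) r) y = 0" if r: "r \<in> poly_over \<rat>" "poly r x = 0" for r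
      proof -
        obtain r' where r': "r = map_poly of_rat r'"
          using r(1) ratpolyE[of r] unfolding poly_over_def by blast
        then have "f dvd r'" using irreducible_root_dvd[OF f x(2)] r(2) by blast
        then obtain k where "r' = f * k" by blast
        then have "r = map_poly of_rat f * map_poly of_rat k" unfolding r' by (simp only: of_rat_poly_mult)
        then show ?thesis using y by (simp add: map_poly_idI)
      qed
      obtain F \<sigma> where F: "is_subfield F" "x \<in> F" "hom_on F \<sigma>" "\<sigma> x = y"
        using hom_extension_to[OF is_subfield_Rats id number_field_algebraic[OF nfL x(1)] conj] by metis
      obtain M \<tau> where M: "is_subfield M" "F \<subseteq> M" "Z \<subseteq> M" "hom_on M \<tau>" "\<forall>x\<in>F. \<tau> x = \<sigma> x"
        using hom_extension[OF finZ algZ F(1,3)] by blast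
      \<comment> \<open>The right-hand side is a subfield, so by minimality it contains
        \<open>L\<close> once it contains \<open>Z\<close>; then \<open>y = \<tau> x\<close> lies in
        \<open>L\<close>.\<close>
      have "Z \<subseteq> {a \<in> M. \<tau> a \<in> L}"
      proof
        fix z assume z: "z \<in> Z"
        then obtain b where b: "b \<in> B" "poly (p b) z = 0" by (auto simp: Z_def)
        have pb: "p b \<in> poly_over \<rat>" using p b by blast
        obtain r' where r': "p b = map_poly of_rat r'"
          using pb ratpolyE[of "p b"] unfolding poly_over_def by blast
        \<comment> \<open>\<open>\<tau>\<close> fixes the rational coefficients of
          \<open>p b\<close>, so it sends roots of \<open>p b\<close> to roots of
          \<open>p b\<close>.\<close>
        have "poly (map_poly \<tau> (p b)) (\<tau> z) = \<tau> (poly (p b) z)"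
          using M z by (intro poly_map_hom[OF M(1,4)]) (auto simp: r' intro!: of_rat_poly_over)
        then have "poly (p b) (\<tau> z) = 0"
          using b hom_on_zero[OF M(1,4)] by (simp add: r' hom_on_of_rat_poly[OF M(1,4)])
        then have "\<tau> z \<in> Z" using b by (auto simp: Z_def)
        then show "z \<in> {a \<in> M. \<tau> a \<in> L}" using ZL M z by blast
      qed
      moreover have "is_subfield {a \<in> M. \<tau> a \<in> L}"
        using Lf M(1) by (intro is_subfieldI)
          (auto simp: hom_on_one[OF M(1,4)] hom_on_add[OF M(1,4)] hom_on_mult[OF M(1,4)]
            hom_on_uminus[OF M(1,4)] hom_on_inverse[OF M(1,4)]
            intro: is_subfield_one is_subfield_add is_subfield_mult is_subfield_uminus is_subfield_inverse)
      ultimately have "\<tau> x \<in> L" using min x(1) by blast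
      then show ?thesis using M F by auto
    qed
    then have "{x \<in> L. poly (map_poly of_rat f) x = 0} = {x. poly (map_poly of_rat f) x = 0}" by blast
    then show ?thesis using card_roots_irreducible[OF f] by metis
  qed
  then have "galois_over_rat L" using nfL unfolding galois_over_rat_def by blast
  with KL show ?thesis by blast
qed

section \<open>Rings of integers and their prime ideals\<close>

text \<open>An integral equation for \<open>x\<close> of degree \<open>d\<close> with leading
  coefficient \<open>c\<close>, multiplied by \<open>c ^ (d - 1)\<close>, becomes a monic equation
  \<open>r\<close> for \<open>c * x\<close>.\<close>

lemma algebraic_int_multiple:
  fixes x :: "'a::field_char_0"
  assumes "Polynomial.algebraic x"
  obtains n :: int where "n \<noteq> 0" "algebraic_int (of_int n * x)"
proof -
  obtain p :: "int poly" where p: "p \<noteq> 0" "poly (map_poly of_int p) x = 0"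
    using assms by (auto elim: algebraicE')
  define c where "c = lead_coeff p"
  define d where "d = Polynomial.degree p"
  have c0: "c \<noteq> 0" using p by (simp add: c_def)
  have "d > 0"
  proof (rule ccontr)
    assume "\<not> d > 0"
    then obtain e where "p = [:e:]"
      by (auto simp: d_def elim: degree_eq_zeroE)
    then show False using p by (auto simp: map_poly_pCons)
  qed
  define r :: "'a poly" where
    "r = Polynomial.monom 1 d +
       (\<Sum>i<d. Polynomial.monom (of_int (Polynomial.coeff p i * c ^ (d - 1 - i))) i)"
  have coeff_r: "Polynomial.coeff r i = (if i = d then 1 else if i < d
      then of_int (Polynomial.coeff p i * c ^ (d - 1 - i)) else 0)" for i
    by (auto simp: r_def coeff_sum)
  have deg: "Polynomial.degree r = d"
    by (rule antisym) (auto intro!: degree_le le_degree simp: coeff_r)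
  have "poly (map_poly of_int p) x = (\<Sum>i\<le>d. of_int (Polynomial.coeff p i) * x ^ i)"
    by (simp add: poly_altdef d_def degree_map_poly coeff_map_poly)
  also have "\<dots> = of_int c * x ^ d + (\<Sum>i<d. of_int (Polynomial.coeff p i) * x ^ i)"
    by (simp add: lessThan_Suc_atMost[symmetric] c_def d_def)
  finally have px: "of_int c * x ^ d + (\<Sum>i<d. of_int (Polynomial.coeff p i) * x ^ i) = 0"
    using p by simp
  have "poly r (of_int c * x) =
      of_int c ^ (d - 1) * (of_int c * x ^ d) +
      (\<Sum>i<d. of_int c ^ (d - 1) * (of_int (Polynomial.coeff p i) * x ^ i))"
  proof -
    have 1: "of_int c ^ d = (of_int c ^ (d - 1) * of_int c :: 'a)"
      using \<open>d > 0\<close> by (simp add: power_eq_if)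
    have 2: "(of_int c :: 'a) ^ (d - 1) = of_int c ^ (d - 1 - i) * of_int c ^ i" if "i < d" for i
      using that by (simp flip: power_add)
    show ?thesis
      by (auto simp: r_def poly_monom poly_sum power_mult_distrib 1 mult_ac intro!: sum.cong)
        (use 2 in \<open>auto simp: mult_ac\<close>)
  qed
  also have "\<dots> = of_int c ^ (d - 1) *
      (of_int c * x ^ d + (\<Sum>i<d. of_int (Polynomial.coeff p i) * x ^ i))"
    by (simp only: distrib_left sum_distrib_left)
  finally have "poly r (of_int c * x) = 0" by (simp add: px)
  then have "algebraic_int (of_int c * x)"
    by (intro algebraic_int.intros[of r]) (auto simp: deg coeff_r)
  with c0 show ?thesis by (rule that)
qed

lemma ring_of_integers_simps [simp]:
  "carrier (ring_of_integers K) = {x \<in> K. algebraic_int x}"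
  "x \<otimes>\<^bsub>ring_of_integers K\<^esub> y = x * y" "x \<oplus>\<^bsub>ring_of_integers K\<^esub> y = x + y"
  "\<one>\<^bsub>ring_of_integers K\<^esub> = 1" "\<zero>\<^bsub>ring_of_integers K\<^esub> = 0"
  by (simp_all add: ring_of_integers_def)

section \<open>A nonzero prime ideal and the rational prime below it\<close>

locale number_field_prime =
  fixes K P :: "'a::field_char_0 set"
  assumes number_field: "number_field K" and prime_ideal: "P \<in> prime_ideals K"
begin

definition OK :: "'a set" where "OK = {x \<in> K. algebraic_int x}"

lemmas K_subfield = number_field_is_subfield[OF number_field]

sublocale R: primeideal P "ring_of_integers K"
  using prime_ideal by (simp add: prime_ideals_def)

lemma carrier_OK: "carrier (ring_of_integers K) = OK"
  by (simp add: OK_def)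

lemma OK_add: "x \<in> OK \<Longrightarrow> y \<in> OK \<Longrightarrow> x + y \<in> OK"
  and OK_mult: "x \<in> OK \<Longrightarrow> y \<in> OK \<Longrightarrow> x * y \<in> OK"
  and OK_one: "1 \<in> OK" and OK_zero: "0 \<in> OK"
  using R.a_closed[of x y] R.m_closed[of x y] R.one_closed R.zero_closed by (simp_all add: OK_def)

lemma OK_uminus: "x \<in> OK \<Longrightarrow> - x \<in> OK"
  by (auto simp: OK_def is_subfield_uminus[OF K_subfield])

lemma OK_diff: "x \<in> OK \<Longrightarrow> y \<in> OK \<Longrightarrow> x - y \<in> OK"
  using OK_add[OF _ OK_uminus] by fastforce

lemma OK_power: "x \<in> OK \<Longrightarrow> x ^ n \<in> OK"
  by (induction n) (auto intro: OK_mult OK_one)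

lemma OK_of_nat: "of_nat n \<in> OK"
  by (induction n) (auto intro: OK_add OK_one OK_zero)

lemma OK_of_int: "of_int n \<in> OK"
  by (cases n) (auto intro: OK_of_nat OK_uminus simp del: of_nat_Suc)

lemma OK_sum: "(\<And>i. i \<in> A \<Longrightarrow> f i \<in> OK) \<Longrightarrow> sum f A \<in> OK"
  by (induction A rule: infinite_finite_induct) (auto intro: OK_add OK_zero)

lemma OK_in_K: "x \<in> OK \<Longrightarrow> x \<in> K"
  by (simp add: OK_def)

lemmas OK_intros = OK_add OK_mult OK_one OK_zero OK_uminus OK_diff OK_power OK_of_nat OK_of_int OK_sum

lemma OK_fraction:
  assumes "x \<in> K"
  obtains a b where "a \<in> OK" "b \<in> OK" "b \<noteq> 0" "x = a / b"
proof -
  obtain n :: int where n: "n \<noteq> 0" "algebraic_int (of_int n * x)"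
    using algebraic_int_multiple[OF number_field_algebraic[OF number_field assms]] by blast
  then have "of_int n * x \<in> OK"
    by (simp add: OK_def is_subfield_mult[OF K_subfield is_subfield_of_int[OF K_subfield] assms])
  with n show ?thesis
    by (intro that[of "of_int n * x" "of_int n"]) (auto intro: OK_of_int)
qed

lemma P_OK: "x \<in> P \<Longrightarrow> x \<in> OK"
  using R.Icarr[of x] by (simp add: OK_def)

lemma P_add: "x \<in> P \<Longrightarrow> y \<in> P \<Longrightarrow> x + y \<in> P"
  using additive_subgroup.a_closed[OF R.additive_subgroup_axioms, of x y] by simp

lemma P_mult: "r \<in> OK \<Longrightarrow> x \<in> P \<Longrightarrow> r * x \<in> P"
  using R.I_l_closed[of x r] by (simp add: OK_def)

lemma P_mult_right: "r \<in> OK \<Longrightarrow> x \<in> P \<Longrightarrow> x * r \<in> P"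
  using P_mult by (simp add: mult.commute)

lemma P_zero: "0 \<in> P"
  using additive_subgroup.zero_closed[OF R.additive_subgroup_axioms] by simp

lemma P_diff: "x \<in> P \<Longrightarrow> y \<in> P \<Longrightarrow> x - y \<in> P"
  using P_add[of x "(- 1) * y"] P_mult[of "- 1" y] OK_intros by auto

lemma P_one: "1 \<notin> P"
proof
  assume "1 \<in> P"
  then have "OK \<subseteq> P" using P_mult[of _ 1] by auto
  then show False using R.I_notcarr P_OK unfolding carrier_OK by blast
qed

lemma P_prime: "a \<in> OK \<Longrightarrow> b \<in> OK \<Longrightarrow> a * b \<in> P \<Longrightarrow> a \<in> P \<or> b \<in> P"
  using R.I_prime[of a b] by (simp add: OK_def)

lemma compl_mult: "a \<in> OK - P \<Longrightarrow> b \<in> OK - P \<Longrightarrow> a * b \<in> OK - P"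
  using P_prime OK_mult by auto

lemma compl_one: "1 \<in> OK - P"
  using P_one OK_one by auto

lemma compl_power: "a \<in> OK - P \<Longrightarrow> a ^ n \<in> OK - P"
  by (induction n) (auto simp: compl_one[simplified] compl_mult[simplified])

lemma compl_nonzero: "a \<in> OK - P \<Longrightarrow> a \<noteq> 0"
  using P_zero by auto

text \<open>Take an integer polynomial annihilating \<open>a\<close> and strip factors of the
  variable until the constant coefficient is nonzero; that coefficient is the multiple
  \<open>m\<close> of \<open>a\<close>.\<close>

lemma OK_divides_int:
  assumes "a \<in> OK" "a \<noteq> 0"
  obtains m :: int and e where "m \<noteq> 0" "e \<in> OK" "e * a = of_int m"
proof -
  have "Polynomial.algebraic a" using assms by (auto simp: OK_def)
  then obtain p :: "int poly" where p: "p \<noteq> 0" "poly (map_poly of_int p) a = 0"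
    by (auto elim: algebraicE')
  have "\<exists>(m::int) e. m \<noteq> 0 \<and> e \<in> OK \<and> e * a = of_int m"
    using p
  proof (induction p rule: pCons_induct)
    case (pCons c p)
    have "poly (map_poly of_int p) a \<in> OK"
      unfolding poly_altdef using assms by (intro OK_intros) (auto simp: coeff_map_poly intro!: OK_intros)
    then have *: "- poly (map_poly of_int p) a \<in> OK" by (rule OK_uminus)
    show ?case
    proof (cases "c = 0")
      case True
      then show ?thesis using pCons assms by (auto simp: map_poly_pCons)
    next
      case False
      have "- poly (map_poly of_int p) a * a = of_int c"
        using pCons.prems by (simp add: map_poly_pCons add_eq_0_iff2 mult.commute minus_equation_iff)
      with False * show ?thesis by blast
    qed
  qed auto
  then show ?thesis using that by blast
qed

text \<open>The least positive integer \<open>q\<close> in \<open>P\<close> works. It is prime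
  because \<open>P\<close> is prime, and an integer of \<open>P\<close> leaves a remainder modulo
  \<open>q\<close> that lies in \<open>P\<close> and is below \<open>q\<close>, hence is
  zero.\<close>

lemma ex_prime_below: "\<exists>q::nat. Factorial_Ring.prime q \<and> P \<inter> \<int> = {of_int (int q * k) | k. True}"
proof -
  have "\<exists>a\<in>P. a \<noteq> 0"
    using prime_ideal P_zero by (auto simp: prime_ideals_def)
  then obtain a where a: "a \<in> P" "a \<noteq> 0" by blast
  obtain m :: int and e where m: "m \<noteq> 0" "e \<in> OK" "e * a = of_int m"
    using OK_divides_int[OF P_OK] a by metis
  have mP: "of_int m \<in> P" using P_mult[OF m(2) a(1)] m by simp
  have "of_int \<bar>m\<bar> \<in> P"
    using mP P_mult[OF OK_of_int[of "-1"], of "of_int m"] by (auto simp: abs_if)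
  then have ex: "\<exists>n. n > 0 \<and> of_nat n \<in> P"
    using m(1) by (intro exI[of _ "nat \<bar>m\<bar>"]) auto
  define q where "q = (LEAST n. n > 0 \<and> of_nat n \<in> P)"
  have q: "q > 0" "of_nat q \<in> P" using LeastI_ex[OF ex] by (auto simp: q_def)
  have least: "q \<le> n" if "n > 0" "of_nat n \<in> P" for n
    using that by (auto simp: q_def intro: Least_le)
  have "q \<noteq> 1" using q P_one by auto
  have "Factorial_Ring.prime q"
    unfolding prime_nat_iff
  proof (intro conjI allI impI)
    show "1 < q" using q \<open>q \<noteq> 1\<close> by simp
    fix n assume n: "n dvd q"
    then obtain k where k: "q = n * k" by blast
    have "of_nat n \<in> P \<or> of_nat k \<in> P"
      using P_prime[of "of_nat n" "of_nat k"] q k OK_of_nat by auto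
    then show "n = 1 \<or> n = q"
    proof
      assume "of_nat n \<in> P" then show ?thesis
        using least[of n] q k n by (auto dest: dvd_imp_le)
    next
      assume "of_nat k \<in> P" then show ?thesis
        using least[of k] q k by auto
    qed
  qed
  moreover have "P \<inter> \<int> = {of_int (int q * k) | k. True}"
  proof (intro equalityI subsetI)
    fix x assume "x \<in> P \<inter> \<int>"
    then obtain k where k: "x = of_int k" "of_int k \<in> P" by (auto elim: Ints_cases)
    have "of_int (k mod int q) \<in> P"
    proof -
      have "k mod int q = k - k div int q * int q" by (simp add: minus_div_mult_eq_mod)
      then have "of_int (k mod int q) = (of_int (k - k div int q * int q) :: 'a)" by (rule arg_cong)
      also have "\<dots> = of_int k - of_int (k div int q) * of_nat q" by simp
      finally have "of_int (k mod int q) = of_int k - of_int (k div int q) * (of_nat q :: 'a)" .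
      then show ?thesis using P_diff[OF k(2) P_mult[OF OK_of_int q(2)]] by simp
    qed
    moreover have "k mod int q \<ge> 0" "k mod int q < int q" using q(1) by auto
    ultimately have "k mod int q = 0"
      using least[of "nat (k mod int q)"] by (cases "k mod int q = 0") auto
    then have "int q dvd k" by (rule mod_0_imp_dvd)
    then show "x \<in> {of_int (int q * k) | k. True}" using k by auto
  next
    fix x :: 'a assume "x \<in> {of_int (int q * k) | k. True}"
    then show "x \<in> P \<inter> \<int>" using P_mult_right[OF OK_of_int q(2)] by auto
  qed
  ultimately show ?thesis by blast
qed

definition q :: nat where "q = prime_below P"

text \<open>Justifies the \<open>THE\<close> in \<open>prime_below\<close>: of two candidates one
  divides the other, and both are prime.\<close>

lemma prime_q: "Factorial_Ring.prime q" and P_Ints: "P \<inter> \<int> = {of_int (int q * k) | k. True}"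
proof -
  obtain r :: nat where r: "Factorial_Ring.prime r" "P \<inter> \<int> = {of_int (int r * k) | k. True}"
    using ex_prime_below by blast
  have "q = r" unfolding q_def prime_below_def
  proof (rule the_equality)
    show "Factorial_Ring.prime r \<and> P \<inter> \<int> = {of_int (int r * k) | k. True}" using r by blast
    fix r' :: nat assume r': "Factorial_Ring.prime r' \<and> P \<inter> \<int> = {of_int (int r' * k) | k. True}"
    have "of_int (int r' * 1) \<in> P \<inter> \<int>" using r' by blast
    then obtain k where "(of_int (int r' * 1) :: 'a) = of_int (int r * k)" using r by blast
    then have "r dvd r'" by (metis dvd_triv_left int_dvd_int_iff mult.right_neutral of_int_eq_iff)
    then show "r' = r" using r r' primes_dvd_imp_eq by blast
  qed
  then show "Factorial_Ring.prime q" "P \<inter> \<int> = {of_int (int q * k) | k. True}"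
    using r by auto
qed

lemma q_P: "of_nat q \<in> P"
proof -
  have "of_int (int q * 1) \<in> P" using P_Ints by blast
  then show ?thesis by simp
qed

lemma of_int_P_iff: "of_int k \<in> P \<longleftrightarrow> int q dvd k"
proof
  assume "of_int k \<in> P"
  then have "of_int k \<in> P \<inter> \<int>" by auto
  then obtain l where "(of_int k :: 'a) = of_int (int q * l)" using P_Ints by blast
  then show "int q dvd k" by (metis dvd_triv_left of_int_eq_iff)
next
  assume "int q dvd k"
  then show "of_int k \<in> P" using P_mult_right[OF OK_of_int q_P] by auto
qed

end

section \<open>The residue ring and powers of a prime ideal\<close>

context number_field_prime
begin

text \<open>Independence of residue classes modulo \<open>q\<close> over the field with
  \<open>q\<close> elements. Integers stand for the coefficients, so that no quotient ring has to be
  formed.\<close>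

definition mod_q_independent :: "'a set \<Rightarrow> bool" where
  "mod_q_independent A \<longleftrightarrow> finite A \<and> A \<subseteq> OK \<and>
     (\<forall>c. (\<exists>b\<in>OK. (\<Sum>a\<in>A. of_int (c a) * a) = of_nat q * b) \<longrightarrow> (\<forall>a\<in>A. int q dvd c a))"

lemma q_gt_1: "q > 1"
  using prime_gt_1_nat[OF prime_q] .

lemma q_nonzero: "(of_nat q :: 'a) \<noteq> 0"
  using q_gt_1 by simp

text \<open>Infinite descent: after clearing denominators, all coefficients of a relation are
  divisible by \<open>q\<close>, and dividing by \<open>q\<close> gives another relation. They are
  thus divisible by every power of \<open>q\<close>, hence zero.\<close>

lemma mod_q_independent_imp_independent:
  assumes "mod_q_independent A" shows "rat_vs.independent A"
proof (rule rat_vs.independent_if_scalars_zero)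
  show fin: "finite A" using assms by (simp add: mod_q_independent_def)
  have dvd: "int q ^ n dvd c a" if "(\<Sum>a\<in>A. of_int (c a) * a) = 0" "a \<in> A" for n c a
    using that
  proof (induction n arbitrary: c)
    case (Suc n)
    have "\<exists>b\<in>OK. (\<Sum>a\<in>A. of_int (c a) * a) = of_nat q * b"
      using Suc.prems(1) OK_zero by (intro bexI[of _ 0]) auto
    then have d: "int q dvd c a" if "a \<in> A" for a
      using assms that by (auto simp: mod_q_independent_def)
    define c' where "c' a = c a div int q" for a
    have c': "c a = int q * c' a" if "a \<in> A" for a
      using d[OF that] by (simp add: c'_def)
    have "of_nat q * (\<Sum>a\<in>A. of_int (c' a) * a) = (\<Sum>a\<in>A. of_int (c a) * a)"
      by (auto simp: sum_distrib_left c' mult.assoc intro!: sum.cong)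
    then have "(\<Sum>a\<in>A. of_int (c' a) * a) = 0"
      using Suc.prems(1) q_nonzero by simp
    from Suc.IH[OF this Suc.prems(2)] show ?case
      using c'[OF Suc.prems(2)] by simp
  qed simp
  fix f :: "'a \<Rightarrow> rat" and x assume f: "(\<Sum>x\<in>A. rat_scale (f x) x) = 0" and x: "x \<in> A"
  \<comment> \<open>A common multiple of the denominators of the coefficients.\<close>
  define D where "D = (\<Prod>a\<in>A. snd (quotient_of (f a)))"
  have D0: "D \<noteq> 0"
    using fin quotient_of_denom_pos'[of "f _"] by (auto simp: D_def less_le)
  have "\<exists>k. of_int k = of_int D * f a" if "a \<in> A" for a
  proof -
    obtain u v where uv: "quotient_of (f a) = (u, v)" by fastforce
    then have fa: "f a = of_int u / of_int v" "v > 0"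
      using quotient_of_div quotient_of_denom_pos by blast+
    have "v dvd D" using dvd_prodI[OF fin that, of "\<lambda>a. snd (quotient_of (f a))"] uv by (simp add: D_def)
    then obtain w where "D = v * w" by blast
    then have "of_int (w * u) = of_int D * f a" using fa by simp
    then show ?thesis by blast
  qed
  then obtain c where c: "\<And>a. a \<in> A \<Longrightarrow> (of_int (c a) :: rat) = of_int D * f a"
    by metis
  have c': "(of_int (c a) :: 'a) = of_int D * of_rat (f a)" if "a \<in> A" for a
    using arg_cong[OF c[OF that], of "of_rat :: rat \<Rightarrow> 'a"] by (simp add: of_rat_mult)
  have "(\<Sum>a\<in>A. of_int (c a) * a) = of_int D * (\<Sum>x\<in>A. rat_scale (f x) x)"
    by (auto simp: sum_distrib_left c' rat_scale_def mult.assoc intro!: sum.cong)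
  then have sum0: "(\<Sum>a\<in>A. of_int (c a) * a) = 0" using f by simp
  have "c x = 0"
  proof (rule ccontr)
    assume "c x \<noteq> 0"
    \<comment> \<open>The exponent is chosen so large that the power of \<open>q\<close> exceeds the
      number it divides.\<close>
    have "int q ^ nat \<bar>c x\<bar> \<le> \<bar>c x\<bar>"
      using dvd_imp_le_int[OF \<open>c x \<noteq> 0\<close> dvd[OF sum0 x, of "nat \<bar>c x\<bar>"]] by simp
    moreover have "nat \<bar>c x\<bar> < q ^ nat \<bar>c x\<bar>"
      using q_gt_1 by (intro power_gt_expt) auto
    then have "\<bar>c x\<bar> < int q ^ nat \<bar>c x\<bar>"
      by (metis nat_less_iff abs_ge_zero of_nat_power)
    ultimately show False by simp
  qed
  then show "f x = 0" using c[OF x] D0 by simp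
qed

text \<open>A largest set \<open>A\<close> independent modulo \<open>q\<close> spans modulo
  \<open>q\<close>. The representatives are the combinations of \<open>A\<close> with coefficients
  below \<open>q\<close>.\<close>

lemma finite_residues:
  obtains R where "finite R" "R \<subseteq> OK" "\<And>a. a \<in> OK \<Longrightarrow> \<exists>r\<in>R. \<exists>b\<in>OK. a = r + of_nat q * b"
proof -
  obtain B where B: "finite B" "B \<subseteq> K" "K \<subseteq> rat_vs.span B"
    by (rule number_field_finite_span[OF number_field])
  have "mod_q_independent {}" by (simp add: mod_q_independent_def)
  \<comment> \<open>The size of a finite spanning set of \<open>K\<close> bounds the size of
    independent sets, so a largest one exists.\<close>
  moreover have "\<forall>A. mod_q_independent A \<longrightarrow> card A < Suc (card B)"
  proof (intro allI impI)
    fix A assume A: "mod_q_independent A"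
    have "A \<subseteq> rat_vs.span B"
      using A B(3) by (auto simp: mod_q_independent_def OK_def)
    then show "card A < Suc (card B)"
      unfolding less_Suc_eq_le using rat_vs.independent_span_bound[OF B(1) mod_q_independent_imp_independent[OF A]] by blast
  qed
  ultimately have "\<exists>A. mod_q_independent A \<and> (\<forall>A'. mod_q_independent A' \<longrightarrow> card A' \<le> card A)"
    by (rule ex_has_greatest_nat)
  then obtain A where A: "mod_q_independent A"
    and max: "\<And>A'. mod_q_independent A' \<Longrightarrow> card A' \<le> card A"
    by blast
  have fin: "finite A" and AO: "A \<subseteq> OK" using A by (auto simp: mod_q_independent_def)
  define R where "R = (\<lambda>d. \<Sum>a\<in>A. of_nat (d a) * a) ` (A \<rightarrow>\<^sub>E {..<q})"
  have finR: "finite R"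
    unfolding R_def by (intro finite_imageI finite_PiE) (use fin in auto)
  have RO: "R \<subseteq> OK"
    using AO by (auto simp: R_def intro!: OK_intros)
  \<comment> \<open>Any integral combination of \<open>A\<close> modulo \<open>q\<close> reduces to
    a representative by taking its coefficients modulo \<open>q\<close>.\<close>
  have red: "\<exists>r\<in>R. \<exists>b\<in>OK. a = r + of_nat q * b"
    if "b \<in> OK" "a = (\<Sum>x\<in>A. of_int (e x) * x) + of_nat q * b" for a b e
  proof -
    define d where "d = (\<lambda>x\<in>A. nat (e x mod int q))"
    have d: "d \<in> A \<rightarrow>\<^sub>E {..<q}"
      using q_gt_1 by (auto simp: d_def nat_less_iff)
    have "of_int (e x) * x = of_nat (d x) * x + of_nat q * (of_int (e x div int q) * x)" if "x \<in> A" for x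
    proof -
      have "e x = int (d x) + int q * (e x div int q)"
        using that q_gt_1 by (simp add: d_def)
      then have "(of_int (e x) :: 'a) = of_int (int (d x) + int q * (e x div int q))" by simp
      also have "\<dots> = of_nat (d x) + of_nat q * of_int (e x div int q)" by simp
      finally show ?thesis by (simp add: algebra_simps)
    qed
    then have "a = (\<Sum>x\<in>A. of_nat (d x) * x + of_nat q * (of_int (e x div int q) * x)) + of_nat q * b"
      using that(2) by simp
    also have "\<dots> = (\<Sum>x\<in>A. of_nat (d x) * x) + of_nat q * ((\<Sum>x\<in>A. of_int (e x div int q) * x) + b)"
      by (simp add: sum.distrib sum_distrib_left algebra_simps)
    finally have "a = (\<Sum>x\<in>A. of_nat (d x) * x) + of_nat q * ((\<Sum>x\<in>A. of_int (e x div int q) * x) + b)" .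
    moreover have "(\<Sum>x\<in>A. of_int (e x div int q) * x) + b \<in> OK"
      using AO that(1) by (auto intro!: OK_intros)
    moreover have "(\<Sum>x\<in>A. of_nat (d x) * x) \<in> R" using d by (auto simp: R_def)
    ultimately show ?thesis by blast
  qed
  have "\<exists>r\<in>R. \<exists>b\<in>OK. a = r + of_nat q * b" if aO: "a \<in> OK" for a
  proof (cases "a \<in> A")
    case True
    have "(\<Sum>x\<in>A. of_int (if x = a then 1 else 0) * x) = (\<Sum>x\<in>A. if x = a then x else 0)"
      by (intro sum.cong) auto
    also have "\<dots> = a" using True fin by simp
    finally show ?thesis
      by (intro red[of 0 _ "\<lambda>x. if x = a then 1 else 0"]) (auto intro: OK_zero)
  next
    case False
    have "\<not> mod_q_independent (insert a A)"
      using max[of "insert a A"] False fin by auto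
    then obtain c b x where c: "b \<in> OK" "(\<Sum>a\<in>insert a A. of_int (c a) * a) = of_nat q * b"
      and x: "x \<in> insert a A" "\<not> int q dvd c x"
      using fin AO aO unfolding mod_q_independent_def by auto
    have sum: "of_int (c a) * a + (\<Sum>a\<in>A. of_int (c a) * a) = of_nat q * b"
      using c(2) False fin by simp
    \<comment> \<open>Otherwise the term at \<open>a\<close> could be absorbed into the right-hand
      side, and independence of \<open>A\<close> would make all coefficients divisible by
      \<open>q\<close>.\<close>
    have nd: "\<not> int q dvd c a"
    proof
      assume d: "int q dvd c a"
      then obtain k where k: "c a = int q * k" by blast
      have "(\<Sum>a\<in>A. of_int (c a) * a) = of_nat q * (b - of_int k * a)"
        using sum k by (simp add: algebra_simps)
      moreover have "b - of_int k * a \<in> OK" using c aO by (intro OK_intros)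
      ultimately have "\<forall>x\<in>A. int q dvd c x"
        using A unfolding mod_q_independent_def by blast
      with d x show False by auto
    qed
    have "coprime (int q) (c a)"
      using nd prime_q by (simp add: prime_imp_coprime)
    \<comment> \<open>\<open>v\<close> inverts \<open>c a\<close> modulo \<open>q\<close>, so the
      relation can be solved for \<open>a\<close>.\<close>
    then obtain u v where uv: "u * int q + v * c a = 1"
      using bezout_int[of "int q" "c a"] by auto
    have "a = of_int (u * int q + v * c a) * a" using uv by simp
    also have "\<dots> = of_nat q * (of_int u * a) + of_int v * (of_int (c a) * a)" by (simp add: algebra_simps)
    also have "of_int (c a) * a = of_nat q * b - (\<Sum>a\<in>A. of_int (c a) * a)"
      using sum by (simp add: algebra_simps)
    finally have "a = (\<Sum>x\<in>A. of_int (- v * c x) * x) + of_nat q * (of_int u * a + of_int v * b)"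
      by (simp add: algebra_simps sum_distrib_left sum_negf)
    moreover have "of_int u * a + of_int v * b \<in> OK" using c aO by (intro OK_intros)
    ultimately show ?thesis by (intro red)
  qed
  with finR RO show ?thesis by (rule that)
qed

lemma residue_pigeonhole:
  fixes f :: "nat \<Rightarrow> 'a"
  assumes "\<And>n. f n \<in> OK"
  obtains i j b where "i < j" "b \<in> OK" "f j - f i = of_nat q * b"
proof -
  obtain R where R: "finite R" "\<And>a. a \<in> OK \<Longrightarrow> \<exists>r\<in>R. \<exists>b\<in>OK. a = r + of_nat q * b"
    using finite_residues by metis
  have "\<forall>n. \<exists>r. r \<in> R \<and> (\<exists>b\<in>OK. f n = r + of_nat q * b)"
    using R(2)[OF assms] by blast
  from choice[OF this] obtain r where r: "\<And>n. r n \<in> R" "\<And>n. \<exists>b\<in>OK. f n = r n + of_nat q * b"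
    by blast
  have "finite (range r)"
    using R(1) r(1) finite_subset[of "range r" R] by blast
  then have "\<not> inj r"
    using finite_imageD[of r UNIV] by auto
  then obtain i j where ij: "i < j" "r i = r j"
    unfolding inj_def by (metis linorder_neqE_nat)
  obtain b b' where "b \<in> OK" "f i = r i + of_nat q * b" "b' \<in> OK" "f j = r j + of_nat q * b'"
    using r(2) by blast
  then show ?thesis
    using that[of i j "b' - b"] ij OK_diff by (simp add: algebra_simps)
qed

text \<open>Maximality of \<open>P\<close>. Pigeonhole on the powers of \<open>s\<close> puts
  \<open>s ^ i * (1 - s ^ k * s)\<close> into \<open>P\<close>; primality cancels
  \<open>s ^ i\<close>, and \<open>s ^ k\<close> is the inverse.\<close>

lemma compl_invertible_mod_P:
  assumes "s \<in> OK - P"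
  obtains t where "t \<in> OK" "1 - t * s \<in> P"
proof -
  have sO: "s \<in> OK" using assms by simp
  obtain i j b where ij: "i < j" "b \<in> OK" "s ^ j - s ^ i = of_nat q * b"
    using residue_pigeonhole[of "\<lambda>n. s ^ n"] OK_power[OF sO] by metis
  obtain k where k: "j = i + Suc k" using less_imp_Suc_add[OF ij(1)] by auto
  have "s ^ i * (1 - s ^ k * s) = of_nat q * (- b)"
    using ij(3) by (simp add: k power_add algebra_simps)
  then have "s ^ i * (1 - s ^ k * s) \<in> P"
    using P_mult_right[OF OK_uminus[OF ij(2)] q_P] by simp
  moreover have "s ^ i \<notin> P" using compl_power[OF assms] by simp
  ultimately have "1 - s ^ k * s \<in> P"
    using P_prime[of "s ^ i" "1 - s ^ k * s"] sO by (auto intro!: OK_intros)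
  then show ?thesis using that OK_power[OF sO] by blast
qed

section \<open>Powers of the prime ideal\<close>

definition pw :: "nat \<Rightarrow> 'a set" where
  "pw n = P [^]\<^bsub>ideals_set (ring_of_integers K)\<^esub> n"

lemma pw_0: "pw 0 = OK" and pw_Suc: "pw (Suc n) = ideal_prod (ring_of_integers K) (pw n) P"
  by (simp_all add: pw_def nat_pow_def ideals_set_def OK_def)

lemma pw_ideal: "ideal (pw n) (ring_of_integers K)"
proof (induction n)
  case 0
  show ?case using R.oneideal by (simp add: pw_0 carrier_OK del: ring_of_integers_simps)
next
  case (Suc n)
  then show ?case using R.ideal_prod_is_ideal[OF Suc R.is_ideal] by (simp add: pw_Suc)
qed

lemma pw_add: "x \<in> pw n \<Longrightarrow> y \<in> pw n \<Longrightarrow> x + y \<in> pw n"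
  using additive_subgroup.a_closed[OF ideal.axioms(1)[OF pw_ideal], of x n y] by simp

lemma pw_mult: "r \<in> OK \<Longrightarrow> x \<in> pw n \<Longrightarrow> r * x \<in> pw n"
  using ideal.I_l_closed[OF pw_ideal, of x n r] by (simp add: OK_def)

lemma pw_mult_right: "r \<in> OK \<Longrightarrow> x \<in> pw n \<Longrightarrow> x * r \<in> pw n"
  using pw_mult by (simp add: mult.commute)

lemma pw_Suc_mult: "x \<in> pw n \<Longrightarrow> y \<in> P \<Longrightarrow> x * y \<in> pw (Suc n)"
  using ideal_prod.prod[of x "pw n" y P "ring_of_integers K"] by (simp add: pw_Suc)

lemma pw_Suc_induct [consumes 1, case_names prod sum]:
  assumes "x \<in> pw (Suc n)" "\<And>i j. i \<in> pw n \<Longrightarrow> j \<in> P \<Longrightarrow> Q (i * j)"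
    "\<And>x y. Q x \<Longrightarrow> Q y \<Longrightarrow> Q (x + y)"
  shows "Q x"
  using assms(1) unfolding pw_Suc
  by (induction rule: ideal_prod.induct) (auto intro: assms(2,3))

lemma pw_Suc_subset: "x \<in> pw (Suc n) \<Longrightarrow> x \<in> pw n"
  by (induction rule: pw_Suc_induct) (auto intro: pw_add pw_mult_right P_OK)

lemma pw_antimono: "m \<le> n \<Longrightarrow> x \<in> pw n \<Longrightarrow> x \<in> pw m"
  by (induction n rule: nat_induct_at_least) (auto dest: pw_Suc_subset)

lemma pw_power: "a \<in> P \<Longrightarrow> a ^ n \<in> pw n"
  by (induction n) (auto simp: pw_0 OK_one mult.commute[of a] intro: pw_Suc_mult)

text \<open>The product of \<open>1 - t * s\<close> in \<open>pw n\<close> and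
  \<open>1 - t' * s\<close> in \<open>P\<close> again has the form
  \<open>1 - t'' * s\<close>.\<close>

lemma pw_comaximal:
  assumes "s \<in> OK - P"
  shows "\<exists>t\<in>OK. 1 - t * s \<in> pw n"
proof (induction n)
  case 0
  show ?case by (intro bexI[of _ 0]) (auto simp: pw_0 intro!: OK_intros)
next
  case (Suc n)
  then obtain t where t: "t \<in> OK" "1 - t * s \<in> pw n" by blast
  obtain t' where t': "t' \<in> OK" "1 - t' * s \<in> P" using compl_invertible_mod_P[OF assms] .
  have "(1 - t * s) * (1 - t' * s) = 1 - (t + t' - t * t' * s) * s"
    by (simp add: algebra_simps)
  then have "1 - (t + t' - t * t' * s) * s \<in> pw (Suc n)"
    using pw_Suc_mult[OF t(2) t'(2)] by simp
  moreover have "t + t' - t * t' * s \<in> OK" using t t' assms by (intro OK_intros) auto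
  ultimately show ?case by blast
qed

text \<open>Elements outside \<open>P\<close> are units modulo every power of
  \<open>P\<close>.\<close>

lemma pw_primary:
  assumes "s \<in> OK - P" "a \<in> OK"
  shows "s * a \<in> pw n \<longleftrightarrow> a \<in> pw n"
proof
  assume sa: "s * a \<in> pw n"
  obtain t where t: "t \<in> OK" "1 - t * s \<in> pw n" using pw_comaximal[OF assms(1)] by blast
  have "a = t * (s * a) + a * (1 - t * s)" by (simp add: algebra_simps)
  then show "a \<in> pw n"
    using pw_add[OF pw_mult[OF t(1) sa] pw_mult[OF assms(2) t(2)]] by simp
qed (use assms pw_mult in auto)

lemma ord_integral_pw: "ord_integral K P a = (GREATEST n. a \<in> pw n)"
  by (simp add: ord_integral_def pw_def)

lemma ord_integral_mult_compl:
  assumes "s \<in> OK - P" "a \<in> OK"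
  shows "ord_integral K P (s * a) = ord_integral K P a"
  unfolding ord_integral_pw by (simp add: pw_primary[OF assms])

text \<open>No uniqueness of the value is needed here: the representations of \<open>x\<close> and of \<open>x * (s / t)\<close>
  as fractions yield the same set of candidates.\<close>

lemma ord_at_mult_compl:
  assumes "s \<in> OK - P" "t \<in> OK - P"
  shows "ord_at K P (x * (s / t)) = ord_at K P x"
proof -
  let ?C = "\<lambda>x k. \<exists>a\<in>OK. \<exists>b\<in>OK. a \<noteq> 0 \<and> b \<noteq> 0 \<and> x = a / b \<and>
      k = int (ord_integral K P a) - int (ord_integral K P b)"
  have *: "?C (x * (s / t)) k" if C: "?C x k" and st: "s \<in> OK - P" "t \<in> OK - P" for x k s t
  proof -
    obtain a b where ab: "a \<in> OK" "b \<in> OK" "a \<noteq> 0" "b \<noteq> 0" "x = a / b"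
      "k = int (ord_integral K P a) - int (ord_integral K P b)" using C by blast
    have "s \<noteq> 0" "t \<noteq> 0" using compl_nonzero st by auto
    then have "s * a \<noteq> 0" "t * b \<noteq> 0" "x * (s / t) = (s * a) / (t * b)"
      using ab by (auto simp: mult.commute)
    moreover have "k = int (ord_integral K P (s * a)) - int (ord_integral K P (t * b))"
      using ab st by (simp add: ord_integral_mult_compl)
    moreover have "s * a \<in> OK" "t * b \<in> OK" using ab st OK_mult by auto
    ultimately show ?thesis by blast
  qed
  have nz: "s \<noteq> 0" "t \<noteq> 0" using compl_nonzero assms by auto
  \<comment> \<open>The converse follows by multiplying with the inverse quotient
    \<open>t / s\<close>.\<close>
  have "?C (x * (s / t)) k \<longleftrightarrow> ?C x k" for k
    using *[of x k s t] *[of "x * (s / t)" k t s] assms nz by auto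
  then show ?thesis unfolding ord_at_def carrier_OK by simp
qed

end

section \<open>The local order\<close>

context number_field_prime
begin

text \<open>Divisibility by \<open>q\<close> in the localisation at \<open>P\<close>.\<close>

definition q_divides :: "'a \<Rightarrow> bool" where
  "q_divides y \<longleftrightarrow> (\<exists>s\<in>OK - P. \<exists>b\<in>OK. s * y = of_nat q * b)"

lemma not_q_divides_one: "\<not> q_divides 1"
  using P_mult_right[OF _ q_P] by (auto simp: q_divides_def)

lemma q_divides_mult: "q_divides y \<Longrightarrow> a \<in> OK \<Longrightarrow> q_divides (a * y)"
  unfolding q_divides_def by (metis OK_mult mult.left_commute)

text \<open>Pigeonhole on the powers of \<open>p\<close> makes
  \<open>p ^ i * (1 - p ^ Suc k)\<close> divisible by \<open>q\<close>, and the second factor is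
  outside \<open>P\<close>.\<close>

lemma q_divides_power:
  assumes "p \<in> P"
  obtains i where "q_divides (p ^ i)"
proof -
  obtain i j b where ij: "i < j" "b \<in> OK" "p ^ j - p ^ i = of_nat q * b"
    using residue_pigeonhole[of "\<lambda>n. p ^ n"] OK_power[OF P_OK[OF assms]] by metis
  obtain k where k: "j = i + Suc k" using less_imp_Suc_add[OF ij(1)] by auto
  have "1 - p ^ Suc k \<in> OK - P"
  proof
    show "1 - p ^ Suc k \<in> OK" using P_OK[OF assms] by (intro OK_intros)
    show "1 - p ^ Suc k \<notin> P"
    proof
      assume "1 - p ^ Suc k \<in> P"
      moreover have "p ^ Suc k \<in> P" using P_mult_right[OF OK_power[OF P_OK[OF assms]] assms] by simp
      ultimately show False using P_add[of "1 - p ^ Suc k" "p ^ Suc k"] P_one by simp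
    qed
  qed
  moreover have "(1 - p ^ Suc k) * p ^ i = of_nat q * (- b)"
    using ij(3) by (simp add: k power_add algebra_simps)
  ultimately have "q_divides (p ^ i)"
    unfolding q_divides_def using OK_uminus[OF ij(2)] by blast
  then show ?thesis by (rule that)
qed

text \<open>Start from \<open>1\<close> and, for each \<open>p\<close> in turn, multiply by the
  highest power of \<open>p\<close> that does not yet give local divisibility by \<open>q\<close>.
  The conditions for earlier elements survive the multiplication.\<close>

lemma ex_socle_element:
  assumes "finite F" "F \<subseteq> P"
  shows "\<exists>b\<in>OK. \<not> q_divides b \<and> (\<forall>p\<in>F. q_divides (p * b))"
  using assms
proof (induction F rule: finite_induct)
  case empty
  show ?case using OK_one not_q_divides_one by auto
next
  case (insert p F)
  then obtain b where b: "b \<in> OK" "\<not> q_divides b" "\<And>p. p \<in> F \<Longrightarrow> q_divides (p * b)" by auto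
  have p: "p \<in> P" "p \<in> OK" using insert P_OK by auto
  obtain i where "q_divides (p ^ i)" using q_divides_power[OF p(1)] .
  then have "q_divides (p ^ i * b)" using q_divides_mult[of "p ^ i" b] b by (simp add: mult.commute)
  then have ex: "\<exists>m. q_divides (p ^ m * b)" ..
  define m where "m = (LEAST m. q_divides (p ^ m * b))"
  have m: "q_divides (p ^ m * b)" unfolding m_def by (rule LeastI_ex[OF ex])
  have "m \<noteq> 0" using m b(2) by (cases m) auto
  then obtain l where l: "m = Suc l" by (cases m) auto
  have nl: "\<not> q_divides (p ^ l * b)" using not_less_Least[of l "\<lambda>m. q_divides (p ^ m * b)"] l m_def by simp
  have pl: "p ^ l \<in> OK" using p by (intro OK_power)
  have "q_divides (p * (p ^ l * b))" using m l by (simp add: mult.assoc)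
  moreover have "q_divides (r * (p ^ l * b))" if "r \<in> F" for r
    using q_divides_mult[OF b(3)[OF that] pl] by (simp add: mult.left_commute)
  ultimately show ?case using nl OK_mult[OF pl b(1)] by (intro bexI[of _ "p ^ l * b"]) auto
qed

text \<open>Denominators of finitely many elements are multiplied to obtain a single one.\<close>

lemma q_divides_common:
  assumes "finite F" "\<And>p. p \<in> F \<Longrightarrow> q_divides (f p)"
  shows "\<exists>s\<in>OK - P. \<forall>p\<in>F. \<exists>c\<in>OK. s * f p = of_nat q * c"
  using assms
proof (induction F rule: finite_induct)
  case empty
  show ?case using compl_one by auto
next
  case (insert p F)
  then obtain s where s: "s \<in> OK - P" "\<forall>p\<in>F. \<exists>c\<in>OK. s * f p = of_nat q * c" by auto
  obtain t c where t: "t \<in> OK - P" "c \<in> OK" "t * f p = of_nat q * c"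
    using insert.prems[of p] by (auto simp: q_divides_def)
  have "\<exists>c\<in>OK. (s * t) * f r = of_nat q * c" if r: "r \<in> insert p F" for r
  proof (cases "r = p")
    case True
    have "(s * t) * f r = of_nat q * (s * c)" using t True by (simp add: mult.assoc mult.left_commute)
    then show ?thesis using s t OK_mult by blast
  next
    case False
    then obtain d where d: "d \<in> OK" "s * f r = of_nat q * d" using s r by auto
    have "(s * t) * f r = of_nat q * (t * d)" using d by (simp add: mult.assoc mult.left_commute)
    then show ?thesis using d t OK_mult by blast
  qed
  then show ?case using compl_mult[OF s(1) t(1)] by blast
qed

text \<open>With \<open>b\<close> from \<open>ex_socle_element\<close> for the representatives in
  \<open>P\<close>, and \<open>s\<close> a common denominator, \<open>g = s * b / q\<close> works.
  If it were integral, \<open>q\<close> would divide \<open>b\<close> locally.\<close>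

lemma ex_inverse_ideal_element:
  obtains g where "g \<in> K" "g \<notin> OK" "\<And>a. a \<in> P \<Longrightarrow> g * a \<in> OK"
proof -
  obtain R where R: "finite R" "R \<subseteq> OK" "\<And>a. a \<in> OK \<Longrightarrow> \<exists>r\<in>R. \<exists>b\<in>OK. a = r + of_nat q * b"
    using finite_residues by metis
  obtain b where b: "b \<in> OK" "\<not> q_divides b" "\<And>p. p \<in> R \<inter> P \<Longrightarrow> q_divides (p * b)"
    using ex_socle_element[of "R \<inter> P"] R(1) by auto
  obtain s where s: "s \<in> OK - P" "\<forall>p\<in>R \<inter> P. \<exists>c\<in>OK. s * (p * b) = of_nat q * c"
    using q_divides_common[of "R \<inter> P" "\<lambda>p. p * b"] R(1) b(3) by auto
  define g where "g = s * b / of_nat q"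
  have qg: "of_nat q * g = s * b" using q_nonzero by (simp add: g_def)
  have "g \<in> K" unfolding g_def using s b K_subfield
    by (intro is_subfield_divide is_subfield_mult is_subfield_of_nat) (auto simp: OK_def)
  moreover have "g \<notin> OK"
    using b(2) s(1) qg by (metis q_divides_def)
  moreover have "g * a \<in> OK" if a: "a \<in> P" for a
  proof -
    \<comment> \<open>Only finitely many multiples of \<open>b\<close> were controlled; every
      \<open>a\<close> in \<open>P\<close> differs from one of those representatives by a multiple
      of \<open>q\<close>.\<close>
    obtain r d where r: "r \<in> R" "d \<in> OK" "a = r + of_nat q * d" using R(3)[OF P_OK[OF a]] by blast
    have "r \<in> P" using P_diff[OF a P_mult_right[OF r(2) q_P]] r(3) by simp
    then obtain c where c: "c \<in> OK" "s * (r * b) = of_nat q * c" using s r by blast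
    have "of_nat q * (g * a) = (s * b) * a" using qg by (simp add: mult.assoc[symmetric])
    also have "\<dots> = s * (r * b) + of_nat q * (s * b * d)"
      unfolding r(3) by (simp add: algebra_simps)
    also have "\<dots> = of_nat q * (c + s * b * d)" using c by (simp add: algebra_simps)
    finally have "g * a = c + s * b * d" using q_nonzero by simp
    then show ?thesis using c s b r by (auto intro!: OK_intros)
  qed
  ultimately show ?thesis by (rule that)
qed

text \<open>Some \<open>\<pi>\<close> in \<open>P\<close> has \<open>g * \<pi>\<close> outside
  \<open>P\<close>. With \<open>s = g * \<pi>\<close>, the identity
  \<open>s * a = \<pi> * (g * a)\<close> shows that \<open>\<pi>\<close> generates \<open>P\<close>
  locally.\<close>

lemma ex_uniformizer:
  obtains \<pi> s where "\<pi> \<in> P" "\<pi> \<noteq> 0" "s \<in> OK - P" "\<And>a. a \<in> P \<Longrightarrow> \<exists>c\<in>OK. s * a = \<pi> * c"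
proof -
  obtain g where g: "g \<in> K" "g \<notin> OK" "\<And>a. a \<in> P \<Longrightarrow> g * a \<in> OK"
    by (rule ex_inverse_ideal_element) blast
  have "\<exists>a\<in>P. g * a \<notin> P"
  proof (rule ccontr)
    assume "\<not> (\<exists>a\<in>P. g * a \<notin> P)"
    then have stable: "\<And>a. a \<in> P \<Longrightarrow> g * a \<in> P" by blast
    \<comment> \<open>The factor \<open>q\<close> makes all powers of \<open>g\<close> integral, so
      that pigeonhole applies. It cancels afterwards, and \<open>g\<close> satisfies a monic
      equation with integral coefficients.\<close>
    have "g ^ n * of_nat q \<in> P" for n
      by (induction n) (auto simp: q_P mult.assoc intro: stable)
    then have "g ^ n * of_nat q \<in> OK" for n using P_OK by blast
    then obtain i j b where ij: "i < j" "b \<in> OK" "g ^ j * of_nat q - g ^ i * of_nat q = of_nat q * b"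
      by (rule residue_pigeonhole)
    have "of_nat q * (g ^ j - g ^ i) = of_nat q * b" using ij(3) by (simp add: algebra_simps)
    then have eq: "g ^ j - g ^ i = b" using q_nonzero by simp
    define p :: "'a poly" where "p = Polynomial.monom 1 j - Polynomial.monom 1 i"
    have coeff_p: "Polynomial.coeff p k = (if k = j then 1 else if k = i then - 1 else 0)" for k
      using ij(1) by (auto simp: p_def)
    have deg: "Polynomial.degree p = j"
      using ij(1) by (intro antisym degree_le le_degree) (auto simp: coeff_p)
    have "algebraic_int g"
    proof (rule algebraic_int_root)
      show "algebraic_int b" using ij(2) by (simp add: OK_def)
      show "poly p g = b" using eq by (simp add: p_def poly_monom)
    qed (use ij(1) in \<open>auto simp: deg coeff_p\<close>)
    with g show False by (simp add: OK_def)
  qed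
  then obtain \<pi> where \<pi>: "\<pi> \<in> P" "g * \<pi> \<notin> P" by blast
  have "\<exists>c\<in>OK. (g * \<pi>) * a = \<pi> * c" if "a \<in> P" for a
    using g(3)[OF that] by (intro bexI[of _ "g * a"]) (auto simp: mult_ac)
  moreover have "\<pi> \<noteq> 0" using \<pi> P_zero by auto
  moreover have "g * \<pi> \<in> OK - P" using g(3) \<pi> by blast
  ultimately show ?thesis using \<pi>(1) that by blast
qed

end

text \<open>The assumptions say that \<open>\<pi>\<close> generates the maximal ideal of the
  localisation at \<open>P\<close>, with the single denominator \<open>s\<close> for all of
  \<open>P\<close>.\<close>

locale number_field_uniformizer = number_field_prime +
  fixes \<pi> s
  assumes \<pi>_P: "\<pi> \<in> P" and \<pi>_nonzero: "\<pi> \<noteq> 0" and s_compl: "s \<in> OK - P"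
    and uniformizer: "\<And>a. a \<in> P \<Longrightarrow> \<exists>c\<in>OK. s * a = \<pi> * c"
begin

text \<open>The denominator \<open>s ^ n\<close> depends on \<open>n\<close> only, so it also serves
  for sums of products.\<close>

lemma pw_local: "a \<in> pw n \<Longrightarrow> \<exists>c\<in>OK. s ^ n * a = \<pi> ^ n * c"
proof (induction n arbitrary: a)
  case 0
  then show ?case by (auto simp: pw_0)
next
  case (Suc n)
  from Suc.prems show ?case
  proof (induction rule: pw_Suc_induct)
    case (prod i j)
    obtain c d where c: "c \<in> OK" "s ^ n * i = \<pi> ^ n * c" and d: "d \<in> OK" "s * j = \<pi> * d"
      using Suc.IH[OF prod(1)] uniformizer[OF prod(2)] by blast
    have "s ^ Suc n * (i * j) = (s ^ n * i) * (s * j)" by (simp add: mult_ac)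
    also have "\<dots> = \<pi> ^ Suc n * (c * d)" unfolding c d by (simp add: mult_ac)
    finally show ?case using c d OK_mult by blast
  next
    case (sum x y)
    then show ?case using OK_add by (metis distrib_left)
  qed
qed

text \<open>In the localisation at \<open>P\<close>, \<open>a\<close> is \<open>\<pi> ^ n\<close>
  times a unit.\<close>

definition has_local_order :: "nat \<Rightarrow> 'a \<Rightarrow> bool" where
  "has_local_order n a \<longleftrightarrow> (\<exists>t\<in>OK - P. \<exists>c\<in>OK - P. t * a = \<pi> ^ n * c)"

text \<open>If \<open>a\<close> were in \<open>pw (Suc n)\<close>, cancelling
  \<open>\<pi> ^ n\<close> would express \<open>s ^ Suc n * c\<close>, a product of elements outside
  \<open>P\<close>, as a multiple of \<open>\<pi>\<close>.\<close>

lemma has_local_order_pw_iff: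
  assumes "has_local_order n a" "a \<in> OK"
  shows "a \<in> pw m \<longleftrightarrow> m \<le> n"
proof
  obtain t c where t: "t \<in> OK - P" "c \<in> OK - P" "t * a = \<pi> ^ n * c"
    using assms by (auto simp: has_local_order_def)
  have "t * a \<in> pw n" using t pw_mult_right[OF _ pw_power[OF \<pi>_P]] by simp
  then have n: "a \<in> pw n" using pw_primary[OF t(1) assms(2)] by simp
  show "a \<in> pw m" if "m \<le> n" using pw_antimono[OF that n] .
  show "m \<le> n" if m: "a \<in> pw m"
  proof (rule ccontr)
    assume "\<not> m \<le> n"
    then have "a \<in> pw (Suc n)" using pw_antimono[of "Suc n" m] m by simp
    then obtain d where d: "d \<in> OK" "s ^ Suc n * a = \<pi> ^ Suc n * d" using pw_local by blast
    have "\<pi> ^ n * (s ^ Suc n * c) = s ^ Suc n * (t * a)" using t by (simp add: mult_ac)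
    also have "\<dots> = t * (s ^ Suc n * a)" by (simp only: mult_ac)
    also have "\<dots> = \<pi> ^ n * (\<pi> * (t * d))" unfolding d by (simp add: mult_ac)
    finally have "s ^ Suc n * c = \<pi> * (t * d)" using \<pi>_nonzero by simp
    also have "\<dots> \<in> P" using P_mult_right[OF _ \<pi>_P] t d OK_mult by simp
    finally show False using compl_mult[OF compl_power[OF s_compl] t(2)] by blast
  qed
qed

lemma ord_integral_eq: "has_local_order n a \<Longrightarrow> a \<in> OK \<Longrightarrow> ord_integral K P a = n"
  unfolding ord_integral_pw by (rule Greatest_equality) (auto simp: has_local_order_pw_iff)

text \<open>Some nonzero multiple \<open>m = q ^ k * m'\<close> of \<open>a\<close> is an integer,
  with \<open>m'\<close> outside \<open>P\<close>. Locally \<open>q\<close> divides some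
  \<open>\<pi> ^ i\<close>, so \<open>q ^ k\<close> divides \<open>\<pi> ^ (i * k)\<close>, and
  \<open>m\<close> cannot lie in the next power of \<open>P\<close>.\<close>

lemma ex_not_pw:
  assumes "a \<in> OK" "a \<noteq> 0"
  shows "\<exists>N. a \<notin> pw N"
proof -
  obtain m :: int and e where m: "m \<noteq> 0" "e \<in> OK" "e * a = of_int m"
    using OK_divides_int[OF assms] .
  obtain k m' where m': "m = int q ^ k * m'" "\<not> int q dvd m'"
  proof -
    have "\<not> is_unit (int q)" using q_gt_1 by simp
    from multiplicity_decompose'[OF m(1) this] show ?thesis using that by metis
  qed
  have m'P: "of_int m' \<in> OK - P" using m'(2) of_int_P_iff OK_of_int by blast
  obtain i where "q_divides (\<pi> ^ i)" using q_divides_power[OF \<pi>_P] .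
  then obtain t c where t: "t \<in> OK - P" "c \<in> OK" "t * \<pi> ^ i = of_nat q * c"
    by (auto simp: q_divides_def)
  let ?N = "Suc (i * k)"
  have "a \<notin> pw ?N"
  proof
    assume "a \<in> pw ?N"
    then have "of_int m \<in> pw ?N" using pw_mult[OF m(2)] m(3) by metis
    then obtain d where d: "d \<in> OK" "s ^ ?N * of_int m = \<pi> ^ ?N * d" using pw_local by blast
    have "t ^ k * \<pi> ^ (i * k) = of_nat q ^ k * c ^ k"
      using arg_cong[OF t(3), of "\<lambda>x. x ^ k"] by (simp add: power_mult_distrib power_mult)
    then have "\<pi> ^ (i * k) * (s ^ ?N * of_int m' * t ^ k) = s ^ ?N * of_int m' * (of_nat q ^ k * c ^ k)"
      by (simp add: mult_ac)
    also have "\<dots> = (s ^ ?N * of_int m) * c ^ k" using m'(1) by (simp add: mult_ac)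
    also have "\<dots> = \<pi> ^ (i * k) * (\<pi> * (d * c ^ k))" unfolding d by (simp add: mult_ac)
    finally have "s ^ ?N * of_int m' * t ^ k = \<pi> * (d * c ^ k)" using \<pi>_nonzero by simp
    also have "\<dots> \<in> P" using P_mult_right[OF _ \<pi>_P] t d OK_mult OK_power by simp
    finally show False
      using compl_mult[OF compl_mult[OF compl_power[OF s_compl] m'P] compl_power[OF t(1)]] by blast
  qed
  then show ?thesis by blast
qed

text \<open>\<open>n\<close> is the last exponent with \<open>a\<close> in \<open>pw n\<close>. If
  the cofactor \<open>c\<close> were in \<open>P\<close>, it would yield one more factor
  \<open>\<pi>\<close> and put \<open>a\<close> into \<open>pw (Suc n)\<close>.\<close>

lemma ex_local_order:
  assumes "a \<in> OK" "a \<noteq> 0"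
  obtains n where "has_local_order n a"
proof -
  define N where "N = (LEAST N. a \<notin> pw N)"
  have N: "a \<notin> pw N" unfolding N_def by (rule LeastI_ex[OF ex_not_pw[OF assms]])
  have "N \<noteq> 0" using N assms by (cases N) (auto simp: pw_0)
  then obtain n where n: "N = Suc n" by (cases N) auto
  have an: "a \<in> pw n" using not_less_Least[of n "\<lambda>N. a \<notin> pw N"] n N_def by simp
  obtain c where c: "c \<in> OK" "s ^ n * a = \<pi> ^ n * c" using pw_local[OF an] by blast
  have "c \<notin> P"
  proof
    assume "c \<in> P"
    then obtain d where d: "d \<in> OK" "s * c = \<pi> * d" using uniformizer by blast
    have "s ^ Suc n * a = s * (s ^ n * a)" by (simp add: mult_ac)
    also have "\<dots> = \<pi> ^ n * (s * c)" unfolding c by (simp add: mult_ac)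
    also have "\<dots> = \<pi> ^ Suc n * d" unfolding d by (simp add: mult_ac)
    also have "\<dots> \<in> pw (Suc n)" using pw_mult_right[OF d(1) pw_power[OF \<pi>_P]] .
    finally have "a \<in> pw (Suc n)" using pw_primary[OF compl_power[OF s_compl] assms(1)] by blast
    with N n show False by simp
  qed
  with c have "has_local_order n a"
    unfolding has_local_order_def using compl_power[OF s_compl] by blast
  then show ?thesis by (rule that)
qed

section \<open>Integer orders of field elements\<close>

definition has_order :: "int \<Rightarrow> 'a \<Rightarrow> bool" where
  "has_order k x \<longleftrightarrow> (\<exists>t\<in>OK - P. \<exists>c\<in>OK - P. t * x = \<pi> powi k * c)"

text \<open>Used in both directions, this gives uniqueness of the order. If \<open>k\<close>
  exceeded \<open>l\<close>, then \<open>t * c'\<close> would be a multiple of \<open>\<pi>\<close>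
  although both factors are outside \<open>P\<close>.\<close>

lemma has_order_mono:
  assumes "has_order k x" "has_order l x" shows "k \<le> l"
proof (rule ccontr)
  assume "\<not> k \<le> l"
  then obtain n where n: "k = l + int (Suc n)"
    by (metis add.commute linorder_not_le zless_iff_Suc_zadd)
  obtain t c t' c' where t: "t \<in> OK - P" "c \<in> OK - P" "t * x = \<pi> powi k * c"
    and t': "t' \<in> OK - P" "c' \<in> OK - P" "t' * x = \<pi> powi l * c'"
    using assms by (auto simp: has_order_def)
  have "\<pi> powi l * (t * c') = t * (t' * x)" using t' by (simp add: mult_ac)
  also have "\<dots> = t' * (t * x)" by (simp add: mult_ac)
  also have "\<dots> = \<pi> powi l * (\<pi> * (\<pi> ^ n * (c * t')))"
    unfolding t n using \<pi>_nonzero by (simp add: power_int_add mult_ac power_int_of_nat del: of_nat_Suc)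
  finally have "t * c' = \<pi> * (\<pi> ^ n * (c * t'))" using \<pi>_nonzero by simp
  also have "\<dots> \<in> P"
    using t t' P_OK[OF \<pi>_P] by (intro P_mult_right[OF _ \<pi>_P] OK_intros) auto
  finally show False using compl_mult[OF t(1) t'(2)] by blast
qed

lemma has_order_fraction:
  assumes "has_local_order m a" "has_local_order n b" "b \<noteq> 0"
  shows "has_order (int m - int n) (a / b)"
proof -
  obtain t c t' c' where t: "t \<in> OK - P" "c \<in> OK - P" "t * a = \<pi> ^ m * c"
    and t': "t' \<in> OK - P" "c' \<in> OK - P" "t' * b = \<pi> ^ n * c'"
    using assms by (auto simp: has_local_order_def)
  have nz: "\<pi> ^ n \<noteq> 0" "c' \<noteq> 0" "t' \<noteq> 0" using \<pi>_nonzero compl_nonzero t' by auto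
  have b: "b = \<pi> ^ n * c' / t'" using t'(3) nz by (simp add: field_simps)
  have "(t * c') * (a / b) = (t * a) * t' / \<pi> ^ n"
    unfolding b using nz by (simp add: field_simps)
  also have "\<dots> = \<pi> powi (int m - int n) * (c * t')"
    unfolding t using \<pi>_nonzero by (simp add: power_int_diff field_simps)
  finally show ?thesis
    unfolding has_order_def using compl_mult t t' by blast
qed

text \<open>Justifies the \<open>THE\<close> in \<open>ord_at\<close>: every fraction representing
  \<open>x\<close> yields an order of \<open>x\<close>, and orders are unique.\<close>

lemma has_order_ord_at:
  assumes "x \<in> K" "x \<noteq> 0"
  shows "has_order (ord_at K P x) x"
proof -
  obtain a b where ab: "a \<in> OK" "b \<in> OK" "b \<noteq> 0" "x = a / b" using OK_fraction[OF assms(1)] .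
  have a0: "a \<noteq> 0" using ab assms by auto
  obtain m n where mn: "has_local_order m a" "has_local_order n b"
    using ex_local_order ab a0 by metis
  have x: "has_order (int m - int n) x" using has_order_fraction[OF mn ab(3)] ab by simp
  have "ord_at K P x = int m - int n"
    unfolding ord_at_def carrier_OK
  proof (rule the_equality)
    show "\<exists>a\<in>OK. \<exists>b\<in>OK. a \<noteq> 0 \<and> b \<noteq> 0 \<and> x = a / b \<and>
        int m - int n = int (ord_integral K P a) - int (ord_integral K P b)"
      using ab a0 ord_integral_eq mn by blast
    fix k assume "\<exists>a\<in>OK. \<exists>b\<in>OK. a \<noteq> 0 \<and> b \<noteq> 0 \<and> x = a / b \<and>
        k = int (ord_integral K P a) - int (ord_integral K P b)"
    then obtain a' b' where ab': "a' \<in> OK" "b' \<in> OK" "a' \<noteq> 0" "b' \<noteq> 0" "x = a' / b'"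
      "k = int (ord_integral K P a') - int (ord_integral K P b')" by blast
    obtain m' n' where mn': "has_local_order m' a'" "has_local_order n' b'"
      using ex_local_order ab' by metis
    have "has_order k x"
      using has_order_fraction[OF mn' ab'(4)] ab' ord_integral_eq mn' by simp
    then show "k = int m - int n" using has_order_mono[OF x] has_order_mono[OF _ x] by force
  qed
  with x show ?thesis by simp
qed

text \<open>The ramification index is positive, so dividing by it in \<open>valuation\<close>
  preserves the ordering.\<close>

lemma ord_at_q_pos: "ord_at K P (of_nat q) > 0"
proof (rule ccontr)
  assume "\<not> ord_at K P (of_nat q) > 0"
  then obtain n where n: "ord_at K P (of_nat q) = - int n"
    by (metis nonpos_int_cases linorder_not_less)
  have "of_nat q \<in> K" using OK_of_nat OK_in_K by blast
  from has_order_ord_at[OF this q_nonzero] obtain t c where t: "t \<in> OK - P" "c \<in> OK - P"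
    "t * of_nat q = \<pi> powi (- int n) * c" by (auto simp: has_order_def n)
  have "c = \<pi> ^ n * (t * of_nat q)" unfolding t(3) using \<pi>_nonzero by (simp add: power_int_minus)
  also have "\<dots> = (\<pi> ^ n * t) * of_nat q" by (simp add: mult_ac)
  also have "\<dots> \<in> P" using t P_OK[OF \<pi>_P] by (intro P_mult[OF _ q_P] OK_intros) auto
  finally show False using t by blast
qed

lemma ord_at_less_imp_quotient:
  assumes "x \<in> K" "x \<noteq> 0" "y \<in> K" "y \<noteq> 0" "ord_at K P x < ord_at K P y"
  obtains a b where "a \<in> P" "b \<in> OK - P" "y = x * (a / b)"
proof -
  obtain n where n: "ord_at K P y = ord_at K P x + int (Suc n)"
    using assms(5) by (metis add.commute zless_iff_Suc_zadd)
  obtain t c t' c' where t: "t \<in> OK - P" "c \<in> OK - P" "t * y = \<pi> powi (ord_at K P y) * c"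
    and t': "t' \<in> OK - P" "c' \<in> OK - P" "t' * x = \<pi> powi (ord_at K P x) * c'"
    using has_order_ord_at[OF assms(1,2)] has_order_ord_at[OF assms(3,4)] by (auto simp: has_order_def)
  have nz: "t \<noteq> 0" "c' \<noteq> 0" using compl_nonzero t t' by auto
  have "t * y * c' = \<pi> ^ Suc n * c * (\<pi> powi (ord_at K P x) * c')"
    unfolding t n using \<pi>_nonzero by (simp add: power_int_add mult_ac power_int_of_nat del: of_nat_Suc)
  also have "\<dots> = x * (\<pi> ^ Suc n * c * t')" unfolding t'(3)[symmetric] by (simp add: mult_ac)
  finally have "y = x * (\<pi> ^ Suc n * c * t' / (t * c'))" using nz by (simp add: field_simps)
  moreover have "\<pi> ^ Suc n * c * t' \<in> P"
  proof -
    have "\<pi> ^ Suc n * c * t' = \<pi> * (\<pi> ^ n * c * t')" by (simp add: mult_ac)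
    also have "\<dots> \<in> P" using t t' P_OK[OF \<pi>_P] by (intro P_mult_right[OF _ \<pi>_P] OK_intros) auto
    finally show ?thesis .
  qed
  moreover have "t * c' \<in> OK - P" using compl_mult t t' by blast
  ultimately show ?thesis using that by blast
qed

end

section \<open>Differentiability\<close>

lemma galois_extension:
  assumes "number_field K"
  shows "K \<subseteq> galois_extension K" "galois_over_rat (galois_extension K)"
  unfolding galois_extension_def
  using someI_ex[OF ex_galois_closure[OF assms]] by auto

text \<open>As \<open>Q\<close> meets the integers of \<open>K\<close> exactly in \<open>P\<close>,
  neither \<open>s\<close> nor \<open>t\<close> lies in \<open>Q\<close>, so both are units in the
  localisation at \<open>Q\<close>.\<close>

lemma valuation_mult_quotient:
  assumes "number_field_prime L Q" "K \<subseteq> L" "Q \<inter> carrier (ring_of_integers K) = P"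
    and "s \<in> carrier (ring_of_integers K) - P" "t \<in> carrier (ring_of_integers K) - P"
  shows "valuation L Q (x * (s / t)) = valuation L Q x"
proof -
  interpret L: number_field_prime L Q by fact
  have "s \<in> L.OK - Q" "t \<in> L.OK - Q"
    using assms by (auto simp: L.OK_def)
  then show ?thesis
    unfolding valuation_def by (simp only: L.ord_at_mult_compl)
qed

text \<open>All valuations above \<open>P\<close> agree at the two arguments, so the sums coincide
  term by term and only the leading factor \<open>x\<close> changes.\<close>

lemma arith_deriv_mult_quotient:
  assumes "number_field K" "s \<in> carrier (ring_of_integers K) - P" "t \<in> carrier (ring_of_integers K) - P"
    and "s \<noteq> 0" "t \<noteq> 0"
  shows "arith_deriv K {P} (x * (s / t)) = arith_deriv K {P} x * (s / t)"
proof -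
  let ?L = "galois_extension K"
  have L: "K \<subseteq> ?L" "number_field ?L"
    using galois_extension[OF assms(1)] by (auto simp: galois_over_rat_def)
  have v: "valuation ?L Q (x * (s / t)) = valuation ?L Q x" if "Q \<in> primes_above ?L K {P}" for Q
    using that L assms by (intro valuation_mult_quotient[of _ _ K P])
      (auto simp: primes_above_def number_field_prime_def)
  have "(\<Sum>Q | Q \<in> primes_above ?L K {P} \<and> valuation ?L Q (x * (s / t)) \<noteq> 0.
          valuation ?L Q (x * (s / t)) / (of_nat (prime_below Q) * of_nat (num_primes_over (prime_below Q) ?L)))
      = (\<Sum>Q | Q \<in> primes_above ?L K {P} \<and> valuation ?L Q x \<noteq> 0.
          valuation ?L Q x / (of_nat (prime_below Q) * of_nat (num_primes_over (prime_below Q) ?L)))"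
    using v by (intro sum.cong) auto
  then show ?thesis
    using assms(4,5) unfolding arith_deriv_def arith_deriv_galois_def Let_def by (simp only:) simp
qed

lemma arith_deriv_locally_linear:
  assumes "number_field K" "P \<in> prime_ideals K" "0 < c" "c < 1" "x \<in> K" "x \<noteq> 0" "u \<in> K"
    and "abs_val c K P (u - x) < abs_val c K P x"
  shows "arith_deriv K {P} u = arith_deriv K {P} x / x * u"
proof (cases "u = x")
  case True
  then show ?thesis using assms by simp
next
  case False
  interpret number_field_prime K P using assms by unfold_locales
  obtain \<pi> s where us: "\<pi> \<in> P" "\<pi> \<noteq> 0" "s \<in> OK - P" "\<And>a. a \<in> P \<Longrightarrow> \<exists>c\<in>OK. s * a = \<pi> * c"
    using ex_uniformizer by metis
  interpret number_field_uniformizer K P \<pi> s using us by unfold_locales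
  let ?y = "u - x"
  have y: "?y \<in> K" "?y \<noteq> 0" using assms False is_subfield_diff[OF K_subfield] by auto
  have "c powr real_of_rat (valuation K P ?y) < c powr real_of_rat (valuation K P x)"
    using assms y by (simp add: abs_val_def)
  \<comment> \<open>Since \<open>c < 1\<close>, the smaller absolute value belongs to the larger
    valuation.\<close>
  then have "valuation K P x < valuation K P ?y"
    using assms(3,4) powr_mono'[of "real_of_rat (valuation K P ?y)" "real_of_rat (valuation K P x)" c]
    by (meson less_eq_real_def linorder_not_less of_rat_less_eq)
  then have "ord_at K P x < ord_at K P ?y"
    using ord_at_q_pos unfolding valuation_def q_def by (simp add: divide_less_cancel)
  then obtain a b where ab: "a \<in> P" "b \<in> OK - P" "?y = x * (a / b)"
    using ord_at_less_imp_quotient[OF assms(5,6) y] by metis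
  have b0: "b \<noteq> 0" using compl_nonzero ab by blast
  \<comment> \<open>\<open>a\<close> is in \<open>P\<close> and \<open>b\<close> is not. Hence
    \<open>u / x = (a + b) / b\<close> is a quotient of elements outside \<open>P\<close>.\<close>
  have ab': "a + b \<in> OK - P"
    using ab P_OK OK_add P_diff[of "a + b" a] by auto
  have u: "u = x * ((a + b) / b)" using ab(3) b0 by (simp add: field_simps)
  have "arith_deriv K {P} (x * ((a + b) / b)) = arith_deriv K {P} x * ((a + b) / b)"
    using ab ab' b0 compl_nonzero[OF ab'] unfolding carrier_OK[symmetric]
    by (intro arith_deriv_mult_quotient number_field) auto
  then show ?thesis unfolding u using assms(6) by (simp add: mult_ac)
qed

text \<open>Places the local slope in \<open>K\<close>, although the derivative is computed in the
  larger Galois extension.\<close>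

lemma arith_deriv_quotient_Rats: "arith_deriv K T x / x \<in> \<rat>"
  by (simp add: arith_deriv_def arith_deriv_galois_def Let_def)

theorem theorem5p3:
  fixes K P :: "'a::{alg_closed_field, field_char_0} set" and c :: real and x :: 'a
  assumes "number_field K" and "P \<in> prime_ideals K" and "0 < c" and "c < 1"
    and "x \<in> K" and "x \<noteq> 0"
  shows "strictly_differentiable_at (abs_val c K P) K (arith_deriv K {P}) x \<and>
         twice_strictly_differentiable_at (abs_val c K P) K (arith_deriv K {P}) x"
proof -
  let ?N = "abs_val c K P" and ?D = "arith_deriv K {P}"
  define l where "l = ?D x / x"
  have K: "is_subfield K" using assms by (simp add: number_field_is_subfield)
  have l: "l \<in> K"
    using arith_deriv_quotient_Rats is_subfield_Rats_subset[OF K] by (auto simp: l_def)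
  \<comment> \<open>The radius \<open>?N x\<close> serves for every \<open>\<epsilon>\<close>,
    because the difference quotients are constant within it.\<close>
  have \<delta>: "?N x > 0" using assms by (simp add: abs_val_def)
  have D: "?D u = l * u" if "u \<in> K" "?N (u - x) < ?N x" for u
    unfolding l_def using that assms by (intro arith_deriv_locally_linear)
  have q1: "diff_quot ?D u v = l"
    if "u \<in> K" "v \<in> K" "u \<noteq> v" "?N (u - x) < ?N x" "?N (v - x) < ?N x" for u v
    using that by (simp add: diff_quot_def D flip: right_diff_distrib)
  have q2: "diff_quot2 ?D u v w = 0"
    if "u \<in> K" "v \<in> K" "w \<in> K" "u \<noteq> w" "v \<noteq> w"
      "?N (u - x) < ?N x" "?N (v - x) < ?N x" "?N (w - x) < ?N x" for u v w
    using that by (simp add: diff_quot2_def q1)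
  \<comment> \<open>The quotients equal their limits, which are \<open>l\<close> and
    \<open>0\<close>, so the distance to be estimated is \<open>?N 0\<close>.\<close>
  have N0: "?N 0 = 0" by (simp add: abs_val_def)
  show ?thesis
  proof
    show "strictly_differentiable_at ?N K ?D x"
      unfolding strictly_differentiable_at_def using \<delta> q1
      by (intro bexI[OF _ l] allI impI exI[of _ "?N x"]) (auto simp: N0)
    show "twice_strictly_differentiable_at ?N K ?D x"
      unfolding twice_strictly_differentiable_at_def using \<delta> q2
      by (intro bexI[OF _ is_subfield_zero[OF K]] allI impI exI[of _ "?N x"]) (auto simp: N0)
  qed
qed

end
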